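(* Let $m\ge 2$ be an integer. Let $G$ be a strongly unmixed connected graph on the vertex set $[n]$. Then $\mathrm{depth}(S/\mathcal{J}_{K_m,G})=m+n-1$. Moreover, if $G$ is a strongly unmixed graph on $n$ vertices (with vertex set $[n]$) with $t$ connected components, then $\mathrm{depth}(S/\mathcal{J}_{K_m,G})=(m-1)t+n$.
   Context: Let $K$ be a field, $m\ge 2$, $n\ge 1$ integers, $[n]=\{1,\dots,n\}$, and $S=K[x_{ij}: i\in[m],\, j\in[n]]$. For a finite simple graph $G$ on $[n]$ with edge set $E(G)$, the generalized binomial edge ideal of $G$ is $$\mathcal{J}_{K_m,G}=\big(x_{ik}x_{jl}-x_{il}x_{jk} : 1\le i<j\le m,\ \{k,l\}\in E(G),\ k<l\big)\subseteq S.$$ Depth is taken with respect to the homogeneous maximal ideal of $S$. For $m=2$, $J_G=\mathcal{J}_{K_2,G}$ is the binomial edge ideal of $G$. For a vertex $v$, $G-v$ is the induced subgraph on $V(G)\setminus\{v\}$, and for $T\subseteq V(G)$, $G-T$ is the induced subgraph on $V(G)\setminus T$; $c_G(T)$ is the number of connected components of $G-T$. $G_v$ is the graph on $V(G)$ with edge set $E(G)\cup\{\{u,w\}: u\neq w,\ u,w\in\mathcal{N}_G(v)\}$, where $\mathcal{N}_G(v)$ is the set of neighbours of $v$; $G_v-v$ means $(G_v)-v$. A vertex $v$ is a cut vertex of $G$ if $G-v$ has more connected components than $G$. A set $T\subseteq V(G)$ is a cut set of $G$ if every $v\in T$ is a cut vertex of $G-(T\setminus\{v\})$ (so $\emptyset$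 is a cut set); $\mathcal{C}(G)$ is the set of all cut sets of $G$. If $G$ has $c$ connected components, then $J_G$ is unmixed if and only if $c_G(T)=|T|+c$ for every $T\in\mathcal{C}(G)$; this may be taken as the definition of "$J_G$ is unmixed". Strongly unmixed graphs are defined recursively: $G$ is strongly unmixed if every connected component of $G$ is complete, or if $J_G$ is unmixed and there exists a cut vertex $v$ of $G$ such that $G-v$, $G_v$ and $G_v-v$ are all strongly unmixed. *)

theory Defs
  imports
    "HOL-Library.Poly_Mapping"
    "HOL-Library.Extended_Nat"
    "HOL-Algebra.QuotRing"
    "HOL-Algebra.Module"
begin

section \<open>Finite simple graphs\<close>

record 'v sgraph =
  verts :: "'v set"
  edges :: "'v set set"

definition finite_simple_graph :: "'v sgraph \<Rightarrow> bool" where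
  "finite_simple_graph G \<longleftrightarrow>
     finite (verts G) \<and>
     edges G \<subseteq> {{u, w} | u w. u \<in> verts G \<and> w \<in> verts G \<and> u \<noteq> w}"

definition nbrs :: "'v sgraph \<Rightarrow> 'v \<Rightarrow> 'v set" where
  "nbrs G v = {u \<in> verts G. {u, v} \<in> edges G}"

definition del_verts :: "'v sgraph \<Rightarrow> 'v set \<Rightarrow> 'v sgraph" where
  "del_verts G T = \<lparr>verts = verts G - T, edges = {e \<in> edges G. e \<inter> T = {}}\<rparr>"

definition complete_nbrs :: "'v sgraph \<Rightarrow> 'v \<Rightarrow> 'v sgraph" where
  "complete_nbrs G v =
     \<lparr>verts = verts G,
      edges = edges G \<union> {{u, w} | u w. u \<noteq> w \<and> u \<in> nbrs G v \<and> w \<in> nbrs G v}\<rparr>"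

definition reachable :: "'v sgraph \<Rightarrow> ('v \<times> 'v) set" where
  "reachable G =
     {(u, w). u \<in> verts G \<and> w \<in> verts G \<and> (u, w) \<in> {(a, b). {a, b} \<in> edges G}\<^sup>*}"

definition components :: "'v sgraph \<Rightarrow> 'v set set" where
  "components G = verts G // reachable G"

definition num_components :: "'v sgraph \<Rightarrow> nat" where
  "num_components G = card (components G)"

definition connected_graph :: "'v sgraph \<Rightarrow> bool" where
  "connected_graph G \<longleftrightarrow>
     verts G \<noteq> {} \<and> (\<forall>u \<in> verts G. \<forall>w \<in> verts G. (u, w) \<in> reachable G)"

definition complete_components :: "'v sgraph \<Rightarrow> bool" where
  "complete_components G \<longleftrightarrow>
     (\<forall>C \<in> components G. \<forall>u \<in> C. \<forall>w \<in> C. u \<noteq> w \<longrightarrow> {u, w} \<in> edges G)"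

definition cut_vertex :: "'v sgraph \<Rightarrow> 'v \<Rightarrow> bool" where
  "cut_vertex G v \<longleftrightarrow>
     v \<in> verts G \<and> num_components (del_verts G {v}) > num_components G"

definition cut_set :: "'v sgraph \<Rightarrow> 'v set \<Rightarrow> bool" where
  "cut_set G T \<longleftrightarrow>
     T \<subseteq> verts G \<and> (\<forall>v \<in> T. cut_vertex (del_verts G (T - {v})) v)"

text \<open>
  Unmixedness of the binomial edge ideal \<open>J\<^sub>G\<close>, in its combinatorial form, which does not
  depend on the coefficient field.
\<close>

definition unmixed :: "'v sgraph \<Rightarrow> bool" where
  "unmixed G \<longleftrightarrow>
     (\<forall>T. cut_set G T \<longrightarrow> num_components (del_verts G T) = card T + num_components G)"

text \<open>
  On finite simple graphs the recursion is well-founded: for a cut vertex \<open>v\<close>, the graphs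
  \<open>G - v\<close> and \<open>G\<^sub>v - v\<close> have fewer vertices than \<open>G\<close>, and \<open>G\<^sub>v\<close> has strictly more edges.
\<close>

inductive strongly_unmixed :: "'v sgraph \<Rightarrow> bool" where
  complete: "complete_components G \<Longrightarrow> strongly_unmixed G"
| cut: "\<lbrakk>unmixed G; cut_vertex G v;
         strongly_unmixed (del_verts G {v});
         strongly_unmixed (complete_nbrs G v);
         strongly_unmixed (del_verts (complete_nbrs G v) {v})\<rbrakk>
        \<Longrightarrow> strongly_unmixed G"


section \<open>Polynomial rings\<close>

text \<open>
  A polynomial is a finitely supported map from monomials to coefficients, a monomial a finitely
  supported map from indeterminates to exponents. The ring \<open>K[x\<^sub>i : i \<in> I]\<close> consists of
  the polynomials whose monomials only involve indeterminates in \<open>I\<close>.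
\<close>

type_synonym ('i, 'k) mpoly = "('i \<Rightarrow>\<^sub>0 nat) \<Rightarrow>\<^sub>0 'k"

definition mpoly_ring :: "'i set \<Rightarrow> ('i, 'k::comm_ring_1) mpoly ring" where
  "mpoly_ring I =
     \<lparr>carrier = {p. \<forall>t \<in> Poly_Mapping.keys p. Poly_Mapping.keys t \<subseteq> I},
      mult = (*), one = 1, zero = 0, add = (+)\<rparr>"

definition var :: "'i \<Rightarrow> ('i, 'k::comm_ring_1) mpoly" where
  "var i = Poly_Mapping.single (Poly_Mapping.single i 1) 1"

lemma cring_mpoly_ring: "cring (mpoly_ring I :: ('i, 'k::comm_ring_1) mpoly ring)"
proof -
  have mult: "Poly_Mapping.keys t \<subseteq> I"
    if pq: "\<forall>t\<in>Poly_Mapping.keys p. Poly_Mapping.keys t \<subseteq> I"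
       "\<forall>t\<in>Poly_Mapping.keys q. Poly_Mapping.keys t \<subseteq> I"
       "t \<in> Poly_Mapping.keys (p * q)" for t and p q :: "('i, 'k) mpoly"
  proof -
    obtain a b where "t = a + b" "a \<in> Poly_Mapping.keys p" "b \<in> Poly_Mapping.keys q"
      using pq(3) Poly_Mapping.keys_mult[of p q] by blast
    then show ?thesis using pq(1,2) Poly_Mapping.keys_add[of a b] by blast
  qed
  have add: "Poly_Mapping.keys t \<subseteq> I"
    if "\<forall>t\<in>Poly_Mapping.keys p. Poly_Mapping.keys t \<subseteq> I"
       "\<forall>t\<in>Poly_Mapping.keys q. Poly_Mapping.keys t \<subseteq> I"
       "t \<in> Poly_Mapping.keys (p + q)" for t and p q :: "('i, 'k) mpoly"
    using that Poly_Mapping.keys_add[of p q] by blast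
  have "\<exists>q. (\<forall>t\<in>Poly_Mapping.keys q. Poly_Mapping.keys t \<subseteq> I) \<and> q + p = 0"
    if "\<forall>t\<in>Poly_Mapping.keys p. Poly_Mapping.keys t \<subseteq> I" for p :: "('i, 'k) mpoly"
    using that by (intro exI[of _ "- p"]) (simp add: Poly_Mapping.keys_def)
  then show ?thesis
    by (intro cringI abelian_groupI comm_monoidI)
       (auto simp: mpoly_ring_def algebra_simps intro: mult add
             dest: subsetD[OF mult] subsetD[OF add])
qed

lemma var_in_mpoly_ring: "i \<in> I \<Longrightarrow> var i \<in> carrier (mpoly_ring I)"
  by (auto simp: mpoly_ring_def var_def)


section \<open>Depth\<close>

definition quot_module :: "('a, 'b) ring_scheme \<Rightarrow> 'a set \<Rightarrow> ('a, 'a set) module" where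
  "quot_module R J =
     ring.extend (R Quot J)
       (module.fields (\<lambda>r X. (J +>\<^bsub>R\<^esub> r) \<otimes>\<^bsub>R Quot J\<^esub> X))"

lemma quot_module_simps:
  "carrier (quot_module R J) = carrier (R Quot J)"
  "monoid.mult (quot_module R J) = monoid.mult (R Quot J)"
  "one (quot_module R J) = one (R Quot J)"
  "zero (quot_module R J) = zero (R Quot J)"
  "add (quot_module R J) = add (R Quot J)"
  "r \<odot>\<^bsub>quot_module R J\<^esub> X = (J +>\<^bsub>R\<^esub> r) \<otimes>\<^bsub>R Quot J\<^esub> X"
  by (simp_all add: quot_module_def ring.defs module.defs)

lemma module_quot_module:
  assumes "cring R" "ideal J R"
  shows "module R (quot_module R J)"
proof -
  interpret R: cring R by fact
  interpret J: ideal J R by fact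
  interpret Q: cring "R Quot J" by (rule J.quotient_is_cring) fact
  interpret h: ring_hom_ring R "R Quot J" "(+>\<^bsub>R\<^esub>) J" by (rule J.rcos_ring_hom_ring)
  have "\<exists>Y \<in> carrier (R Quot J). Y \<oplus>\<^bsub>R Quot J\<^esub> X = \<zero>\<^bsub>R Quot J\<^esub>"
    if "X \<in> carrier (R Quot J)" for X
    using that Q.l_neg Q.a_inv_closed by blast
  then have "abelian_group (quot_module R J)"
    by (intro abelian_groupI; simp only: quot_module_simps) (simp_all add: Q.a_ac)
  then show ?thesis
    by (intro moduleI)
       (auto simp: quot_module_simps R.is_cring Q.l_distr Q.r_distr Q.m_assoc)
qed

text \<open>\<open>(f\<^sub>1, \<dots>, f\<^sub>r) M = f\<^sub>1 M + \<dots> + f\<^sub>r M\<close>\<close>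

fun seq_submodule :: "('a, 'm, 'c) module_scheme \<Rightarrow> 'a list \<Rightarrow> 'm set" where
  "seq_submodule M [] = {\<zero>\<^bsub>M\<^esub>}"
| "seq_submodule M (f # fs) =
     {(f \<odot>\<^bsub>M\<^esub> x) \<oplus>\<^bsub>M\<^esub> y | x y. x \<in> carrier M \<and> y \<in> seq_submodule M fs}"

text \<open>
  Each \<open>f\<^sub>i\<close> is a nonzerodivisor on \<open>M / (f\<^sub>1, \<dots>, f\<^sub>i\<^sub>-\<^sub>1) M\<close>,
  and \<open>(f\<^sub>1, \<dots>, f\<^sub>r) M \<noteq> M\<close>.
\<close>

definition regular_sequence ::
    "('a, 'b) ring_scheme \<Rightarrow> ('a, 'm, 'c) module_scheme \<Rightarrow> 'a list \<Rightarrow> bool" where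
  "regular_sequence R M fs \<longleftrightarrow>
     set fs \<subseteq> carrier R \<and>
     (\<forall>i < length fs. \<forall>x \<in> carrier M.
        fs ! i \<odot>\<^bsub>M\<^esub> x \<in> seq_submodule M (take i fs) \<longrightarrow> x \<in> seq_submodule M (take i fs)) \<and>
     seq_submodule M fs \<noteq> carrier M"

definition depth ::
    "('a, 'b) ring_scheme \<Rightarrow> 'a set \<Rightarrow> ('a, 'm, 'c) module_scheme \<Rightarrow> enat" where
  "depth R I M = Sup {enat (length fs) | fs. set fs \<subseteq> I \<and> regular_sequence R M fs}"


section \<open>Generalized binomial edge ideals\<close>

definition edge_poly_ring :: "nat \<Rightarrow> nat sgraph \<Rightarrow> (nat \<times> nat, 'k::field) mpoly ring" where
  "edge_poly_ring m G = mpoly_ring ({1..m} \<times> verts G)"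

definition homogeneous_max_ideal :: "nat \<Rightarrow> nat sgraph \<Rightarrow> (nat \<times> nat, 'k::field) mpoly set" where
  "homogeneous_max_ideal m G =
     Idl\<^bsub>edge_poly_ring m G\<^esub> {var (i, k) | i k. i \<in> {1..m} \<and> k \<in> verts G}"

definition gen_binomial_edge_ideal :: "nat \<Rightarrow> nat sgraph \<Rightarrow> (nat \<times> nat, 'k::field) mpoly set" where
  "gen_binomial_edge_ideal m G =
     Idl\<^bsub>edge_poly_ring m G\<^esub>
       {var (i, k) * var (j, l) - var (i, l) * var (j, k) | i j k l.
          1 \<le> i \<and> i < j \<and> j \<le> m \<and> {k, l} \<in> edges G \<and> k < l}"

text \<open>
  The coefficient field \<open>K\<close> occurs only as a type; it is selected by the first argument.
\<close>

definition depth_edge_quotient :: "'k::field itself \<Rightarrow> nat \<Rightarrow> nat sgraph \<Rightarrow> enat" where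
  "depth_edge_quotient K m G =
     depth (edge_poly_ring m G :: (nat \<times> nat, 'k) mpoly ring)
       (homogeneous_max_ideal m G)
       (quot_module (edge_poly_ring m G) (gen_binomial_edge_ideal m G))"

end

theory Submission
  imports Defs Complex_Main "HOL-Library.Product_Lexorder"
begin

text \<open>
  Write \<open>(x\<^sub>v)\<close> for the ideal of the variables \<open>x\<^sub>i\<^sub>v\<close> of a vertex \<open>v\<close>, and \<open>J(G)\<close> for the generalized
  binomial edge ideal. The proof rests on a decomposition that holds at every vertex,
  \<open>J(G) = J(G\<^sub>v) \<inter> (J(G - v) + (x\<^sub>v))\<close>, where the sum of the two ideals on the right is
  \<open>J(G\<^sub>v - v) + (x\<^sub>v)\<close> (\<open>edge_ideal_Int\<close>, \<open>edge_ideal_sum\<close>). The reason is that a minor of two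
  neighbour columns of \<open>v\<close>, multiplied by any variable of \<open>v\<close>, is an explicit combination of minors
  of edges at \<open>v\<close>; the part of an element of \<open>J(G\<^sub>v)\<close> that involves the variables of \<open>v\<close> therefore
  lies in \<open>J(G)\<close>.

  The decomposition gives an exact sequence
  \<open>0 \<rightarrow> S/(I \<inter> J) \<rightarrow> S/I \<oplus> S/J \<rightarrow> S/(I + J) \<rightarrow> 0\<close>, to which the depth lemma applies.
  Let \<open>G\<close> have \<open>n\<close> vertices and \<open>t\<close> components, and let \<open>v\<close> be the cut vertex of the recursion.
  Since \<open>{v}\<close> is a cut set, unmixedness says that \<open>G - v\<close> has \<open>t + 1\<close> components, while \<open>G\<^sub>v\<close>
  and \<open>G\<^sub>v - v\<close> have \<open>t\<close>. By induction the three depths are \<open>(m-1)t + n\<close> for \<open>G\<^sub>v\<close>,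
  \<open>(m-1)(t+1) + n - 1\<close> for \<open>G - v\<close>, which is no smaller because \<open>m \<ge> 2\<close>, and
  \<open>(m-1)t + n - 1\<close> for \<open>G\<^sub>v - v\<close>. The cokernel has smaller depth than the middle term, so the
  kernel has depth exactly one more than the cokernel (\<open>depth_strongly_unmixed\<close>).

  If all components are complete, \<open>S/J(G)\<close> is a tensor product of coordinate rings of Segre
  products, that is, a subring of a polynomial ring generated by monomials. There a variable
  \<open>x\<^sub>i\<^sub>k\<close> is a nonzerodivisor, and adding it to the ideal gives the intersection of the ideals
  where row \<open>i\<close> respectively column \<open>k\<close> of the block is set to zero. These have the same form, so
  the depth lemma computes the depth by induction once more (\<open>depth_segre_ideal\<close>).

  The depth lemma is proved for pairs of ideals by elementary means. Over a Noetherian ring an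
  ideal without socle has a nonzerodivisor in the maximal ideal, which can be chosen in common for
  several such ideals; as regular sequences may be started with any nonzerodivisor
  (\<open>depth_ge_adjoin\<close>), all terms can be reduced modulo a common one. The Noetherian property is
  Hilbert's basis theorem.

  All ideals live in one ring, the polynomials in the variables \<open>x\<^sub>i\<^sub>k\<close> for all natural numbers
  \<open>i\<close>, \<open>k\<close>, and contain the variables that do not belong to the graph. Deleting a vertex
  then means killing its variables, and graphs with different vertex sets can be compared. This ring
  is not Noetherian, but it is so above the ideal generated by all but finitely many variables.
  The last part transfers the result to the polynomial ring of the given graph.
\<close>

section \<open>Ideals and nonzerodivisors\<close>

text \<open>
  An ideal of a commutative ring type is a submodule of the ring over itself:
  \<open>ideals.subspace\<close> says that a set is an ideal, and \<open>ideals.span\<close> is the ideal generated by a set.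
\<close>

interpretation ideals: Modules.module "(*) :: 'a::comm_ring_1 \<Rightarrow> 'a \<Rightarrow> 'a"
  by standard (simp_all add: algebra_simps)

(* as a rewrite rule it is mult.assoc reversed, and the two together loop *)
declare ideals.scale_scale [simp del]

definition adjoin :: "'a::comm_ring_1 set \<Rightarrow> 'a \<Rightarrow> 'a set" where
  "adjoin J f = ideals.span (insert f J)"

definition nonzerodivisor_mod :: "'a::comm_ring_1 set \<Rightarrow> 'a \<Rightarrow> bool" where
  "nonzerodivisor_mod J f \<longleftrightarrow> (\<forall>x. f * x \<in> J \<longrightarrow> x \<in> J)"

definition colon :: "'a::comm_ring_1 set \<Rightarrow> 'a \<Rightarrow> 'a set" where
  "colon J a = {r. r * a \<in> J}"

lemma mem_adjoin:
  assumes "ideals.subspace J"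
  shows "x \<in> adjoin J f \<longleftrightarrow> (\<exists>k. x - k * f \<in> J)"
  unfolding adjoin_def ideals.span_insert ideals.span_eq_iff[THEN iffD2, OF assms] by simp

lemma mem_ideal_sum:
  assumes "ideals.subspace I" "ideals.subspace J"
  shows "x \<in> ideals.span (I \<union> J) \<longleftrightarrow> (\<exists>i\<in>I. \<exists>j\<in>J. x = i + j)"
  unfolding ideals.span_Un ideals.span_eq_iff[THEN iffD2, OF assms(1)]
    ideals.span_eq_iff[THEN iffD2, OF assms(2)] by blast

lemma ideal_adjoin: "ideals.subspace (adjoin J f)"
  by (simp add: adjoin_def)

lemma adjoin_superset: "J \<subseteq> adjoin J f"
  by (auto simp: adjoin_def intro: ideals.span_base)

lemma adjoin_self: "f \<in> adjoin J f"
  by (simp add: adjoin_def ideals.span_base)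

lemma adjoin_commute: "adjoin (adjoin J f) g = adjoin (adjoin J g) f"
proof -
  have "adjoin (adjoin J f) g = ideals.span (insert g (insert f J))" for f g
  proof
    show "adjoin (adjoin J f) g \<subseteq> ideals.span (insert g (insert f J))"
      unfolding adjoin_def
      using ideals.span_mono[of "insert f J" "insert g (insert f J)"]
      by (intro ideals.span_minimal) (auto intro: ideals.span_base)
    show "ideals.span (insert g (insert f J)) \<subseteq> adjoin (adjoin J f) g"
      unfolding adjoin_def
      by (intro ideals.span_mono) (auto intro: ideals.span_base)
  qed
  then show ?thesis by (simp add: insert_commute)
qed

lemma span_Un_adjoin: "ideals.span (A \<union> adjoin J f) = ideals.span (insert f A \<union> J)"
proof
  have "adjoin J f \<subseteq> ideals.span (insert f A \<union> J)"
    unfolding adjoin_def by (intro ideals.span_mono) auto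
  then show "ideals.span (A \<union> adjoin J f) \<subseteq> ideals.span (insert f A \<union> J)"
    by (intro ideals.span_minimal) (auto intro: ideals.span_base)
  show "ideals.span (insert f A \<union> J) \<subseteq> ideals.span (A \<union> adjoin J f)"
    using adjoin_superset[of J f] adjoin_self[of f J] by (intro ideals.span_mono) auto
qed

lemma ideal_mult_left: "ideals.subspace J \<Longrightarrow> x \<in> J \<Longrightarrow> c * x \<in> J"
  by (rule ideals.subspace_scale)

lemma ideal_mult_right: "ideals.subspace J \<Longrightarrow> x \<in> J \<Longrightarrow> x * c \<in> J"
  using ideals.subspace_scale[of J x c] by (simp add: mult.commute)

lemma adjoin_cong:
  assumes "ideals.subspace J" "f - g \<in> J"
  shows "adjoin J f = adjoin J g"
proof -
  have *: "x \<in> adjoin J g" if x: "x \<in> adjoin J f" and fg: "f - g \<in> J" for x f g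
  proof -
    obtain k where k: "x - k * f \<in> J" using x unfolding mem_adjoin[OF assms(1)] by blast
    have "x - k * g = (x - k * f) + k * (f - g)" by (simp add: algebra_simps)
    also have "\<dots> \<in> J"
      by (intro ideals.subspace_add[OF assms(1)] ideals.subspace_scale[OF assms(1)] k fg)
    finally show ?thesis using mem_adjoin[OF assms(1)] by blast
  qed
  have "g - f \<in> J" using ideals.subspace_neg[OF assms] by simp
  then show ?thesis using *[of _ f g] *[of _ g f] assms(2) by auto
qed

lemma nonzerodivisor_mod_cong:
  assumes J: "ideals.subspace J" "f - g \<in> J" and "nonzerodivisor_mod J f"
  shows "nonzerodivisor_mod J g"
  unfolding nonzerodivisor_mod_def
proof (intro allI impI)
  fix x assume "g * x \<in> J"
  then have "g * x + (f - g) * x \<in> J"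
    by (rule ideals.subspace_add[OF J(1) _ ideal_mult_right[OF J]])
  then have "f * x \<in> J" by (simp add: algebra_simps)
  then show "x \<in> J" using assms(3) by (simp add: nonzerodivisor_mod_def)
qed

lemma ideal_colon:
  assumes "ideals.subspace J"
  shows "ideals.subspace (colon J a)"
proof (rule ideals.subspaceI)
  show "0 \<in> colon J a" using ideals.subspace_0[OF assms] by (simp add: colon_def)
  show "x + y \<in> colon J a" if "x \<in> colon J a" "y \<in> colon J a" for x y
    using that ideals.subspace_add[OF assms] by (simp add: colon_def distrib_right)
  show "c * x \<in> colon J a" if "x \<in> colon J a" for c x
    using that ideals.subspace_scale[OF assms] by (simp add: colon_def mult.assoc)
qed

section \<open>Prime avoidance\<close>

definition prime_ideal_set :: "'a::comm_ring_1 set \<Rightarrow> bool" where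
  "prime_ideal_set P \<longleftrightarrow>
     ideals.subspace P \<and> 1 \<notin> P \<and> (\<forall>x y. x * y \<in> P \<longrightarrow> x \<in> P \<or> y \<in> P)"

text \<open>
  A product of elements, one from each \<open>Q\<close> and outside \<open>P\<close>, is in every \<open>Q\<close> and still outside \<open>P\<close>.
\<close>

lemma prime_avoids_intersection:
  assumes "finite \<Q>" "prime_ideal_set P" "\<And>Q. Q \<in> \<Q> \<Longrightarrow> ideals.subspace Q"
    "\<And>Q. Q \<in> \<Q> \<Longrightarrow> \<not> Q \<subseteq> P"
  shows "\<exists>y. y \<notin> P \<and> (\<forall>Q\<in>\<Q>. y \<in> Q)"
  using assms(1,3,4)
proof (induction \<Q>)
  case empty
  then show ?case using assms(2) by (auto simp: prime_ideal_set_def)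
next
  case (insert Q \<Q>)
  then obtain y where y: "y \<notin> P" "\<forall>Q\<in>\<Q>. y \<in> Q" by auto
  obtain q where q: "q \<in> Q" "q \<notin> P" using insert.prems(2) by blast
  have "q * y \<notin> P" using y(1) q(2) assms(2) unfolding prime_ideal_set_def by blast
  moreover have "\<forall>R\<in>insert Q \<Q>. q * y \<in> R"
    using y(2) q(1) insert.prems(1) by (auto intro: ideal_mult_left ideal_mult_right)
  ultimately show ?case by blast
qed

text \<open>
  If \<open>x\<close> avoids all primes but \<open>P\<close>, it is corrected by some \<open>y \<in> I\<close> outside \<open>P\<close> that lies in all the
  other primes not contained in \<open>P\<close>; the primes contained in \<open>P\<close> are avoided together with \<open>P\<close>.
\<close>

lemma prime_avoidance:
  assumes "finite \<P>" "\<And>P. P \<in> \<P> \<Longrightarrow> prime_ideal_set P"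
    "ideals.subspace I" "\<And>P. P \<in> \<P> \<Longrightarrow> \<not> I \<subseteq> P"
  shows "\<exists>f\<in>I. \<forall>P\<in>\<P>. f \<notin> P"
  using assms(1,2,4)
proof (induction \<P>)
  case empty
  then show ?case using ideals.subspace_0[OF assms(3)] by blast
next
  case (insert P \<P>)
  then obtain x where x: "x \<in> I" "\<forall>P\<in>\<P>. x \<notin> P" by auto
  have P: "prime_ideal_set P" using insert.prems by blast
  have idl: "ideals.subspace Q" if "Q \<in> insert P \<P>" for Q
    using insert.prems(1)[OF that] by (simp add: prime_ideal_set_def)
  show ?case
  proof (cases "x \<in> P")
    case False
    then show ?thesis using x by blast
  next
    case True
    \<comment> \<open>including \<open>I\<close> among the ideals makes the correction an element of \<open>I\<close>\<close>
    let ?Q = "insert I {Q \<in> \<P>. \<not> Q \<subseteq> P}"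
    have "\<exists>y. y \<notin> P \<and> (\<forall>Q\<in>?Q. y \<in> Q)"
      using insert.hyps(1) P insert.prems idl assms(3)
      by (intro prime_avoids_intersection) auto
    then obtain y where y: "y \<notin> P" "y \<in> I" "\<And>Q. Q \<in> \<P> \<Longrightarrow> \<not> Q \<subseteq> P \<Longrightarrow> y \<in> Q" by auto
    have xyP: "x + y \<notin> P"
      using True y(1) idl[of P] ideals.subspace_diff[of P "x + y" x] by auto
    have "x + y \<notin> Q" if Q: "Q \<in> \<P>" for Q
    proof (cases "Q \<subseteq> P")
      case False
      then show ?thesis
        using y(3)[OF Q False] x(2) Q idl[of Q] ideals.subspace_diff[of Q "x + y" y] by auto
    qed (use xyP in blast)
    then show ?thesis using xyP x(1) y(2) assms(3) ideals.subspace_add by blast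
  qed
qed

text \<open>
  Exactness of \<open>0 \<rightarrow> S/(I \<inter> J) \<rightarrow> S/I \<oplus> S/J \<rightarrow> S/(I + J) \<rightarrow> 0\<close> survives reduction modulo an
  element that is regular on the cokernel. A common element \<open>i + x f = j + y f\<close> of both sides has
  \<open>x - y\<close> in \<open>I + J\<close>, and splitting this difference makes the two coefficients of \<open>f\<close> equal.
\<close>

lemma adjoin_Int:
  assumes "ideals.subspace I" "ideals.subspace J"
    and f: "nonzerodivisor_mod (ideals.span (I \<union> J)) f"
  shows "adjoin I f \<inter> adjoin J f = adjoin (I \<inter> J) f"
proof
  have IJ: "ideals.subspace (I \<inter> J)" using assms by (simp add: ideals.subspace_inter)
  show "adjoin I f \<inter> adjoin J f \<subseteq> adjoin (I \<inter> J) f"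
  proof
    fix w assume "w \<in> adjoin I f \<inter> adjoin J f"
    then obtain x y where x: "w - x * f \<in> I" and y: "w - y * f \<in> J"
      using mem_adjoin assms by blast
    have "f * (x - y) = (w - y * f) - (w - x * f)" by (simp add: algebra_simps)
    also have "\<dots> \<in> ideals.span (I \<union> J)"
      using x y by (intro ideals.span_diff[OF ideals.span_base ideals.span_base]) auto
    finally have "x - y \<in> ideals.span (I \<union> J)" using f by (simp add: nonzerodivisor_mod_def)
    then obtain i j where ij: "i \<in> I" "j \<in> J" "x - y = i + j"
      using mem_ideal_sum[OF assms(1,2)] by blast
    have "w - (x - i) * f = (w - x * f) + f * i" by (simp add: algebra_simps)
    then have 1: "w - (x - i) * f \<in> I"
      using x ij(1) assms(1) ideals.subspace_add ideals.subspace_scale by metis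
    have "w - (x - i) * f = (w - (y + j) * f)" using ij(3) by (simp add: algebra_simps)
    also have "\<dots> = (w - y * f) - f * j" by (simp add: algebra_simps)
    also have "\<dots> \<in> J" using y ij(2) assms(2) by (simp add: ideals.subspace_diff ideals.subspace_scale)
    finally show "w \<in> adjoin (I \<inter> J) f" using 1 mem_adjoin[OF IJ] by blast
  qed
  show "adjoin (I \<inter> J) f \<subseteq> adjoin I f \<inter> adjoin J f"
    unfolding adjoin_def by (intro Int_greatest ideals.span_mono) auto
qed

lemma span_adjoin_Un:
  "ideals.span (adjoin I f \<union> adjoin J f) = adjoin (ideals.span (I \<union> J)) f"
proof
  have "adjoin I f \<subseteq> adjoin (ideals.span (I \<union> J)) f" for I J :: "'a set"
    unfolding adjoin_def
    by (intro ideals.span_mono) (auto intro: ideals.span_base)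
  from this[of I J] this[of J I]
  show "ideals.span (adjoin I f \<union> adjoin J f) \<subseteq> adjoin (ideals.span (I \<union> J)) f"
    by (intro ideals.span_minimal) (auto simp: ideal_adjoin Un_commute)
  have "ideals.span (I \<union> J) \<subseteq> ideals.span (adjoin I f \<union> adjoin J f)"
    by (intro ideals.span_mono Un_mono adjoin_superset)
  then show "adjoin (ideals.span (I \<union> J)) f \<subseteq> ideals.span (adjoin I f \<union> adjoin J f)"
    unfolding adjoin_def[of "ideals.span (I \<union> J)"]
    by (intro ideals.span_minimal) (auto intro!: ideals.span_base simp: adjoin_self)
qed

section \<open>Depth and the depth lemma\<close>

text \<open>
  The intended ring has infinitely many variables. It becomes Noetherian modulo the ideal \<open>Z\<close> of all
  but finitely many of them, and \<open>Z\<close> may vary from one application to the next. The regular sequences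
  are taken in \<open>\<mm>\<close>.
\<close>

locale noetherian_over =
  fixes \<mm> Z :: "'a::comm_ring_1 set"
  assumes ideal_m: "ideals.subspace \<mm>" and one_notin_m: "1 \<notin> \<mm>"
    and fin_gen: "\<And>A. ideals.subspace A \<Longrightarrow> Z \<subseteq> A \<Longrightarrow> \<exists>F. finite F \<and> A = ideals.span (F \<union> Z)"
begin

definition admissible :: "'a set \<Rightarrow> bool" where
  "admissible J \<longleftrightarrow> ideals.subspace J \<and> Z \<subseteq> J \<and> J \<subseteq> \<mm>"

text \<open>
  For an admissible \<open>J\<close> this is depth \<open>0\<close> of the quotient by \<open>J\<close>: a nonzero element that is
  annihilated by \<open>\<mm>\<close>.
\<close>

definition has_socle :: "'a set \<Rightarrow> bool" where
  "has_socle J \<longleftrightarrow> (\<exists>a. a \<notin> J \<and> (\<forall>h\<in>\<mm>. h * a \<in> J))"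

text \<open>
  There is a sequence of length \<open>k\<close> in \<open>\<mm>\<close> that is regular modulo \<open>J\<close>. The quotients stay nonzero
  by themselves, since admissible ideals lie in \<open>\<mm>\<close>.
\<close>

primrec depth_ge :: "nat \<Rightarrow> 'a set \<Rightarrow> bool" where
  "depth_ge 0 J \<longleftrightarrow> True"
| "depth_ge (Suc k) J \<longleftrightarrow> (\<exists>f\<in>\<mm>. nonzerodivisor_mod J f \<and> depth_ge k (adjoin J f))"

lemma admissible_adjoin: "admissible J \<Longrightarrow> f \<in> \<mm> \<Longrightarrow> admissible (adjoin J f)"
  unfolding admissible_def adjoin_def
  using ideals.span_minimal[OF _ ideal_m, of "insert f J"] ideals.span_superset[of "insert f J"]
    ideals.subspace_span[of "insert f J"]
  by blast

lemma admissible_Int: "admissible I \<Longrightarrow> admissible J \<Longrightarrow> admissible (I \<inter> J)"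
  unfolding admissible_def by (auto simp: ideals.subspace_inter)

lemma admissible_sum: "admissible I \<Longrightarrow> admissible J \<Longrightarrow> admissible (ideals.span (I \<union> J))"
  unfolding admissible_def
  using ideals.span_minimal[OF _ ideal_m, of "I \<union> J"] ideals.span_superset[of "I \<union> J"]
  by blast

lemma maximal_ideal_exists:
  assumes "\<A> \<noteq> {}" "\<And>A. A \<in> \<A> \<Longrightarrow> ideals.subspace A \<and> Z \<subseteq> A"
  shows "\<exists>M\<in>\<A>. \<forall>X\<in>\<A>. M \<subseteq> X \<longrightarrow> X = M"
proof (rule subset_Zorn_nonempty[OF assms(1)])
  fix \<C> assume ne: "\<C> \<noteq> {}" and ch: "subset.chain \<A> \<C>"
  have C: "ideals.subspace A \<and> Z \<subseteq> A" if "A \<in> \<C>" for A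
    using assms(2) ch that unfolding subset.chain_def by blast
  have two: "\<exists>A\<in>\<C>. x \<in> A \<and> y \<in> A" if "x \<in> \<Union>\<C>" "y \<in> \<Union>\<C>" for x y
    using finite_subset_Union_chain[of "{x, y}" \<C> \<A>] that ne ch by auto
  have "ideals.subspace (\<Union>\<C>)"
  proof (rule ideals.subspaceI)
    show "0 \<in> \<Union>\<C>" using ne C ideals.subspace_0 by blast
    show "x + y \<in> \<Union>\<C>" if "x \<in> \<Union>\<C>" "y \<in> \<Union>\<C>" for x y
      using two[OF that] C ideals.subspace_add by blast
    show "c * x \<in> \<Union>\<C>" if "x \<in> \<Union>\<C>" for c x
      using that C ideals.subspace_scale by blast
  qed
  then obtain F where F: "finite F" "\<Union>\<C> = ideals.span (F \<union> Z)"
    using fin_gen[of "\<Union>\<C>"] ne C by blast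
  then have "F \<subseteq> \<Union>\<C>" using ideals.span_superset by blast
  then obtain B where B: "B \<in> \<C>" "F \<subseteq> B"
    using finite_subset_Union_chain[OF F(1) _ ne ch] by blast
  have "ideals.span (F \<union> Z) \<subseteq> B" using B C by (intro ideals.span_minimal) auto
  then have "\<Union>\<C> = B" using F(2) B(1) by blast
  then show "\<Union>\<C> \<in> \<A>" using B(1) ch unfolding subset.chain_def by blast
qed

text \<open>
  For an admissible \<open>J\<close> these are the maximal associated primes of the quotient, and their union is the
  set of zero divisors.
\<close>

definition maximal_annihilators :: "'a set \<Rightarrow> 'a set set" where
  "maximal_annihilators J =
     {colon J a | a. a \<notin> J \<and> (\<forall>b. b \<notin> J \<longrightarrow> colon J a \<subseteq> colon J b \<longrightarrow> colon J b = colon J a)}"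

lemma colon_subset_maximal:
  assumes "admissible J" "a \<notin> J"
  shows "\<exists>P\<in>maximal_annihilators J. colon J a \<subseteq> P"
proof -
  let ?A = "{colon J b | b. b \<notin> J \<and> colon J a \<subseteq> colon J b}"
  have J: "ideals.subspace J" "Z \<subseteq> J" using assms(1) by (auto simp: admissible_def)
  have "\<exists>M\<in>?A. \<forall>X\<in>?A. M \<subseteq> X \<longrightarrow> X = M"
  proof (rule maximal_ideal_exists)
    show "?A \<noteq> {}" using assms(2) by blast
    have "J \<subseteq> colon J b" for b using ideal_mult_right[OF J(1)] by (auto simp: colon_def)
    then show "ideals.subspace A \<and> Z \<subseteq> A" if "A \<in> ?A" for A
      using that J ideal_colon by blast
  qed
  then obtain b where b: "b \<notin> J" "colon J a \<subseteq> colon J b"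
    and M: "\<forall>X\<in>?A. colon J b \<subseteq> X \<longrightarrow> X = colon J b" by blast
  have max: "colon J c = colon J b"
    if "c \<notin> J" "colon J a \<subseteq> colon J c" "colon J b \<subseteq> colon J c" for c
    using M that by blast
  have "colon J b \<in> maximal_annihilators J"
    using b max unfolding maximal_annihilators_def by blast
  then show ?thesis using b(2) by blast
qed

lemma prime_maximal_annihilator:
  assumes "admissible J" "P \<in> maximal_annihilators J"
  shows "prime_ideal_set P"
proof -
  have J: "ideals.subspace J" using assms(1) by (auto simp: admissible_def)
  obtain a where a: "a \<notin> J" "P = colon J a"
    and max: "\<And>b. b \<notin> J \<Longrightarrow> colon J a \<subseteq> colon J b \<Longrightarrow> colon J b = colon J a"
    using assms(2) unfolding maximal_annihilators_def by blast
  have "x \<in> P" if xy: "x * y \<in> P" "y \<notin> P" for x y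
  proof -
    have "y * a \<notin> J" using xy(2) a(2) by (simp add: colon_def)
    moreover have "colon J a \<subseteq> colon J (y * a)"
      using ideal_mult_left[OF J, of "_ * a" y] by (auto simp: colon_def mult.left_commute)
    ultimately have "colon J (y * a) = colon J a" using max by blast
    then show ?thesis using xy(1) a(2) by (auto simp: colon_def mult.assoc)
  qed
  moreover have "1 \<notin> P" using a by (simp add: colon_def)
  ultimately show ?thesis unfolding prime_ideal_set_def using a(2) ideal_colon[OF J] by blast
qed

text \<open>
  Finitely many of the elements \<open>a\<close> whose annihilator is maximal generate all of them modulo \<open>J\<close>.
  If \<open>b\<close> is one more, the intersection of the finitely many annihilators annihilates \<open>b\<close>, so
  the prime \<open>colon J b\<close> contains one of them and equals it by maximality.
\<close>

lemma finite_maximal_annihilators: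
  assumes "admissible J"
  shows "finite (maximal_annihilators J)"
proof -
  have J: "ideals.subspace J" "Z \<subseteq> J" using assms by (auto simp: admissible_def)
  define E where "E = {a. a \<notin> J \<and> (\<forall>b. b \<notin> J \<longrightarrow> colon J a \<subseteq> colon J b \<longrightarrow> colon J b = colon J a)}"
  let ?A = "{ideals.span (D \<union> J) | D. finite D \<and> D \<subseteq> E}"
  have "\<exists>M\<in>?A. \<forall>X\<in>?A. M \<subseteq> X \<longrightarrow> X = M"
  proof (rule maximal_ideal_exists)
    show "?A \<noteq> {}" by blast
    show "ideals.subspace A \<and> Z \<subseteq> A" if "A \<in> ?A" for A
      using that J(2) ideals.span_superset by fastforce
  qed
  then obtain D where D: "finite D" "D \<subseteq> E"
    and M: "\<forall>X\<in>?A. ideals.span (D \<union> J) \<subseteq> X \<longrightarrow> X = ideals.span (D \<union> J)"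
    by blast
  have max: "ideals.span (D' \<union> J) = ideals.span (D \<union> J)"
    if "finite D'" "D' \<subseteq> E" "ideals.span (D \<union> J) \<subseteq> ideals.span (D' \<union> J)" for D'
    using M that by blast
  have "colon J b \<in> colon J ` D" if b: "b \<in> E" for b
  proof -
    have "ideals.span (insert b D \<union> J) = ideals.span (D \<union> J)"
      using D b by (intro max ideals.span_mono) auto
    then have bD: "b \<in> ideals.span (D \<union> J)"
      using ideals.span_base[of b "insert b D \<union> J"] by auto
    have P: "prime_ideal_set (colon J b)"
      using b by (intro prime_maximal_annihilator[OF assms])
        (auto simp: E_def maximal_annihilators_def)
    have "\<exists>a\<in>D. colon J a \<subseteq> colon J b"
    proof (rule ccontr)
      assume "\<not> ?thesis"
      then have "\<exists>y. y \<notin> colon J b \<and> (\<forall>Q\<in>colon J ` D. y \<in> Q)"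
        using D(1) P ideal_colon[OF J(1)] by (intro prime_avoids_intersection) auto
      then obtain y where y: "y * b \<notin> J" "\<And>a. a \<in> D \<Longrightarrow> y * a \<in> J"
        by (auto simp: colon_def)
      have "b \<in> {x. y * x \<in> J}"
      proof (rule subsetD[OF ideals.span_minimal bD])
        show "D \<union> J \<subseteq> {x. y * x \<in> J}" using y(2) ideal_mult_left[OF J(1)] by auto
        show "ideals.subspace {x. y * x \<in> J}"
          using ideal_colon[OF J(1), of y] by (simp add: colon_def mult.commute)
      qed
      then show False using y(1) by simp
    qed
    then obtain a where "a \<in> D" "colon J a \<subseteq> colon J b" by blast
    moreover have "colon J b = colon J a" using calculation D(2) b by (auto simp: E_def)
    ultimately show ?thesis by blast
  qed
  then have "maximal_annihilators J \<subseteq> colon J ` D"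
    unfolding maximal_annihilators_def E_def by auto
  then show ?thesis using D(1) finite_surj by blast
qed

text \<open>
  The zero divisors modulo the given ideals lie in finitely many primes, none of which contains \<open>\<mm>\<close>,
  because \<open>\<mm> \<subseteq> colon J a\<close> would put \<open>a\<close> into the socle.
\<close>

lemma common_nonzerodivisor:
  assumes "finite \<J>" "\<And>J. J \<in> \<J> \<Longrightarrow> admissible J" "\<And>J. J \<in> \<J> \<Longrightarrow> \<not> has_socle J"
  shows "\<exists>f\<in>\<mm>. \<forall>J\<in>\<J>. nonzerodivisor_mod J f"
proof -
  let ?P = "\<Union>J\<in>\<J>. maximal_annihilators J"
  have "\<exists>f\<in>\<mm>. \<forall>P\<in>?P. f \<notin> P"
  proof (rule prime_avoidance)
    show "finite ?P" using assms(1,2) finite_maximal_annihilators by blast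
    show "prime_ideal_set P" if "P \<in> ?P" for P
      using that assms(2) prime_maximal_annihilator by blast
    show "\<not> \<mm> \<subseteq> P" if P: "P \<in> ?P" for P
    proof -
      obtain J a where "J \<in> \<J>" "a \<notin> J" "P = colon J a"
        using P unfolding maximal_annihilators_def by blast
      then show ?thesis using assms(3)[of J] unfolding has_socle_def colon_def by blast
    qed
  qed (rule ideal_m)
  then obtain f where f: "f \<in> \<mm>" "\<forall>P\<in>?P. f \<notin> P" by blast
  have "nonzerodivisor_mod J f" if J: "J \<in> \<J>" for J
    unfolding nonzerodivisor_mod_def
  proof (intro allI impI, rule ccontr)
    fix x assume "f * x \<in> J" "x \<notin> J"
    then show False
      using colon_subset_maximal[OF assms(2)[OF J]] f(2) J unfolding colon_def by blast
  qed
  then show ?thesis using f(1) by blast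
qed

lemma depth_ge_Suc_no_socle: "depth_ge (Suc k) J \<Longrightarrow> \<not> has_socle J"
  unfolding has_socle_def nonzerodivisor_mod_def depth_ge.simps by blast

text \<open>
  The socles modulo \<open>f\<close> and modulo \<open>g\<close> are isomorphic: a socle element \<open>a\<close> modulo \<open>J + (g)\<close> has
  \<open>f a = b g\<close> modulo \<open>J\<close>, and \<open>b\<close> is the corresponding socle element modulo \<open>J + (f)\<close>.
\<close>

lemma has_socle_exchange:
  assumes J: "ideals.subspace J" and f: "f \<in> \<mm>" "nonzerodivisor_mod J f"
    and g: "g \<in> \<mm>" "nonzerodivisor_mod J g" and "has_socle (adjoin J g)"
  shows "has_socle (adjoin J f)"
proof -
  obtain a where a: "a \<notin> adjoin J g" "\<And>h. h \<in> \<mm> \<Longrightarrow> h * a \<in> adjoin J g"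
    using assms(6) unfolding has_socle_def by blast
  \<comment> \<open>\<open>b = f a / g\<close>, which makes sense as \<open>f a\<close> is divisible by \<open>g\<close> modulo \<open>J\<close>\<close>
  obtain b where b: "f * a - b * g \<in> J" using a(2)[OF f(1)] mem_adjoin[OF J] by blast
  have "b \<notin> adjoin J f"
  proof
    assume "b \<in> adjoin J f"
    then obtain c where c: "b - c * f \<in> J" using mem_adjoin[OF J] by blast
    have "f * (a - c * g) = (f * a - b * g) + g * (b - c * f)" by (simp add: algebra_simps)
    also have "\<dots> \<in> J" using b c J by (simp add: ideals.subspace_add ideals.subspace_scale)
    finally have "a - c * g \<in> J" using f(2) by (simp add: nonzerodivisor_mod_def)
    then show False using a(1) mem_adjoin[OF J] by blast
  qed
  moreover have "h * b \<in> adjoin J f" if h: "h \<in> \<mm>" for h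
  proof -
    obtain c where c: "h * a - c * g \<in> J" using a(2)[OF h] mem_adjoin[OF J] by blast
    have "g * (h * b - c * f) = f * (h * a - c * g) - h * (f * a - b * g)"
      by (simp add: algebra_simps)
    also have "\<dots> \<in> J" using b c J by (simp add: ideals.subspace_diff ideals.subspace_scale)
    finally have "h * b - c * f \<in> J" using g(2) by (simp add: nonzerodivisor_mod_def)
    then show ?thesis using mem_adjoin[OF J] by blast
  qed
  ultimately show ?thesis unfolding has_socle_def by blast
qed

text \<open>
  If \<open>g x = y h\<close> modulo \<open>J\<close>, regularity of \<open>h\<close> modulo \<open>J + (g)\<close> gives \<open>y = z g\<close> modulo \<open>J\<close>, and
  cancelling \<open>g\<close> leaves \<open>x = z h\<close>.
\<close>

lemma nonzerodivisor_swap: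
  assumes J: "ideals.subspace J" and g: "nonzerodivisor_mod J g"
    and h: "nonzerodivisor_mod J h" "nonzerodivisor_mod (adjoin J g) h"
  shows "nonzerodivisor_mod (adjoin J h) g"
  unfolding nonzerodivisor_mod_def
proof (intro allI impI)
  fix x assume "g * x \<in> adjoin J h"
  then obtain y where y: "g * x - y * h \<in> J" using mem_adjoin[OF J] by blast
  have "h * y - x * g = - (g * x - y * h)" by (simp add: algebra_simps)
  then have "h * y \<in> adjoin J g" using y mem_adjoin[OF J] ideals.subspace_neg[OF J] by metis
  then have "y \<in> adjoin J g" using h(2) by (simp add: nonzerodivisor_mod_def)
  then obtain z where z: "y - z * g \<in> J" using mem_adjoin[OF J] by blast
  have "g * (x - z * h) = (g * x - y * h) + h * (y - z * g)" by (simp add: algebra_simps)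
  also have "\<dots> \<in> J" using y z J by (simp add: ideals.subspace_add ideals.subspace_scale)
  finally have "x - z * h \<in> J" using g by (simp add: nonzerodivisor_mod_def)
  then show "x \<in> adjoin J h" using mem_adjoin[OF J] by blast
qed

text \<open>
  All nonzerodivisors of \<open>\<mm>\<close> are equally good beginnings of a regular sequence. To pass from the
  given beginning \<open>g\<close> to \<open>f\<close>, an element \<open>h\<close> is chosen that is regular modulo \<open>J\<close>,
  \<open>J + (f)\<close> and \<open>J + (g)\<close>; it exists by the exchange of socles. Interchanging \<open>h\<close> with \<open>g\<close> and
  then with \<open>f\<close> moves the question to the ideal \<open>J + (h)\<close> and shorter sequences.
\<close>

lemma depth_ge_adjoin:
  assumes "admissible J" "depth_ge (Suc k) J" "f \<in> \<mm>" "nonzerodivisor_mod J f"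
  shows "depth_ge k (adjoin J f)"
  using assms
proof (induction k arbitrary: J f)
  case (Suc k)
  have J: "ideals.subspace J" using Suc.prems(1) by (simp add: admissible_def)
  obtain g where g: "g \<in> \<mm>" "nonzerodivisor_mod J g" "depth_ge (Suc k) (adjoin J g)"
    using Suc.prems(2) by auto
  have "\<not> has_socle (adjoin J g)" using g(3) depth_ge_Suc_no_socle by blast
  moreover from this have "\<not> has_socle (adjoin J f)"
    using has_socle_exchange[OF J g(1,2) Suc.prems(3,4)] by blast
  moreover have "\<not> has_socle J" using Suc.prems(2) depth_ge_Suc_no_socle by blast
  ultimately have "\<exists>h\<in>\<mm>. \<forall>J'\<in>{J, adjoin J f, adjoin J g}. nonzerodivisor_mod J' h"
    using Suc.prems(1,3) g(1) admissible_adjoin by (intro common_nonzerodivisor) auto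
  then obtain h where h: "h \<in> \<mm>" "nonzerodivisor_mod J h"
    "nonzerodivisor_mod (adjoin J f) h" "nonzerodivisor_mod (adjoin J g) h" by auto
  have "depth_ge k (adjoin (adjoin J g) h)"
    using Suc.IH[OF admissible_adjoin g(3) h(1,4)] Suc.prems(1) g(1) by blast
  then have "depth_ge (Suc k) (adjoin J h)"
    using nonzerodivisor_swap[OF J g(2) h(2,4)] g(1) adjoin_commute[of J g h] by auto
  then have "depth_ge k (adjoin (adjoin J h) f)"
    using Suc.IH[OF admissible_adjoin[OF Suc.prems(1) h(1)]] Suc.prems(3)
      nonzerodivisor_swap[OF J Suc.prems(4) h(2,3)] by blast
  then show ?case using h(1,3) adjoin_commute[of J f h] by auto
qed simp

lemma depth_ge_Suc_iff:
  assumes "admissible J" "f \<in> \<mm>" "nonzerodivisor_mod J f"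
  shows "depth_ge (Suc k) J \<longleftrightarrow> depth_ge k (adjoin J f)"
  using depth_ge_adjoin[OF assms(1) _ assms(2,3)] assms(2,3) by auto

lemma depth_ge_decreasing: "depth_ge (Suc k) J \<Longrightarrow> depth_ge k J"
  by (induction k arbitrary: J) auto

lemma depth_ge_antimono: "depth_ge k J \<Longrightarrow> j \<le> k \<Longrightarrow> depth_ge j J"
  by (induction k) (use depth_ge_decreasing le_SucE in blast)+

lemma nonzerodivisor_mod_Int:
  "nonzerodivisor_mod I f \<Longrightarrow> nonzerodivisor_mod J f \<Longrightarrow> nonzerodivisor_mod (I \<inter> J) f"
  unfolding nonzerodivisor_mod_def by blast

text \<open>
  One half of the depth lemma, by reduction modulo an element that is regular on all three terms: the
  depth of the kernel in \<open>0 \<rightarrow> S/(I \<inter> J) \<rightarrow> S/I \<oplus> S/J \<rightarrow> S/(I + J) \<rightarrow> 0\<close> is at least the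
  minimum of the depth of the middle term and one more than the depth of the cokernel.
\<close>

lemma depth_ge_Int:
  assumes "admissible I" "admissible J" "depth_ge (Suc k) I" "depth_ge (Suc k) J"
    "depth_ge k (ideals.span (I \<union> J))"
  shows "depth_ge (Suc k) (I \<inter> J)"
  using assms
proof (induction k arbitrary: I J)
  case 0
  then have "\<exists>f\<in>\<mm>. \<forall>J\<in>{I, J}. nonzerodivisor_mod J f"
    using depth_ge_Suc_no_socle by (intro common_nonzerodivisor) blast+
  then show ?case using nonzerodivisor_mod_Int by auto
next
  case (Suc k)
  have "\<exists>f\<in>\<mm>. \<forall>J\<in>{I, J, ideals.span (I \<union> J)}. nonzerodivisor_mod J f"
    using Suc.prems depth_ge_Suc_no_socle admissible_sum by (intro common_nonzerodivisor) blast+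
  then obtain f where f: "f \<in> \<mm>" "nonzerodivisor_mod I f" "nonzerodivisor_mod J f"
    "nonzerodivisor_mod (ideals.span (I \<union> J)) f" by auto
  have "depth_ge (Suc k) (adjoin I f \<inter> adjoin J f)"
    using Suc.prems f depth_ge_Suc_iff admissible_sum
    by (intro Suc.IH) (simp_all only: admissible_adjoin span_adjoin_Un)
  then have "depth_ge (Suc k) (adjoin (I \<inter> J) f)"
    using adjoin_Int[of I J f] Suc.prems(1,2) f(4) by (simp add: admissible_def)
  then show ?case
    using depth_ge_Suc_iff[OF admissible_Int f(1) nonzerodivisor_mod_Int] Suc.prems(1,2) f(2,3)
    by blast
qed

text \<open>
  The snake lemma for multiplication by a common nonzerodivisor \<open>f\<close>, made explicit: if \<open>x\<close> is in
  the socle modulo \<open>I + J\<close> and \<open>f x = i + a\<close>, then \<open>a\<close> is in the socle modulo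
  \<open>I \<inter> J + (f)\<close>, whose depth is at least one by assumption.
\<close>

lemma no_socle_sum:
  assumes I: "admissible I" and J: "admissible J"
    and "depth_ge (Suc 0) I" "depth_ge (Suc 0) J" "depth_ge (Suc (Suc 0)) (I \<inter> J)"
  shows "\<not> has_socle (ideals.span (I \<union> J))"
proof
  assume "has_socle (ideals.span (I \<union> J))"
  then obtain x where x: "x \<notin> ideals.span (I \<union> J)"
    "\<And>h. h \<in> \<mm> \<Longrightarrow> h * x \<in> ideals.span (I \<union> J)" unfolding has_socle_def by blast
  have idl: "ideals.subspace I" "ideals.subspace J" using I J by (auto simp: admissible_def)
  then have IJ: "ideals.subspace (I \<inter> J)" by (rule ideals.subspace_inter)
  have split: "\<exists>i\<in>I. \<exists>j\<in>J. h * x = i + j" if "h \<in> \<mm>" for h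
    using x(2)[OF that] mem_ideal_sum[OF idl] by blast
  have "\<exists>f\<in>\<mm>. \<forall>J\<in>{I, J}. nonzerodivisor_mod J f"
    using assms depth_ge_Suc_no_socle by (intro common_nonzerodivisor) blast+
  then obtain f where f: "f \<in> \<mm>" "nonzerodivisor_mod I f" "nonzerodivisor_mod J f" by auto
  have "depth_ge (Suc 0) (adjoin (I \<inter> J) f)"
    using assms(5) f admissible_Int[OF I J] nonzerodivisor_mod_Int depth_ge_Suc_iff by blast
  then have ns: "\<not> has_socle (adjoin (I \<inter> J) f)" using depth_ge_Suc_no_socle by blast
  obtain i a where ia: "i \<in> I" "a \<in> J" "f * x = i + a" using split[OF f(1)] by blast
  have "a \<notin> adjoin (I \<inter> J) f"
  proof
    assume "a \<in> adjoin (I \<inter> J) f"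
    then obtain z where z: "a - z * f \<in> I" "a - z * f \<in> J" using mem_adjoin[OF IJ] by blast
    have "f * z = a - (a - z * f)" by (simp add: algebra_simps)
    then have "f * z \<in> J" using ia(2) z(2) ideals.subspace_diff[OF idl(2)] by metis
    then have zJ: "z \<in> J" using f(3) by (simp add: nonzerodivisor_mod_def)
    have "f * (x - z) = i + (a - z * f)" using ia(3) by (simp add: algebra_simps)
    then have "f * (x - z) \<in> I" using ia(1) z(1) idl(1) by (simp add: ideals.subspace_add)
    then have xzI: "x - z \<in> I" using f(2) by (simp add: nonzerodivisor_mod_def)
    have "(x - z) + z \<in> ideals.span (I \<union> J)"
      using zJ xzI by (intro ideals.span_add) (auto intro: ideals.span_base)
    then show False using x(1) by simp
  qed
  moreover have "h * a \<in> adjoin (I \<inter> J) f" if h: "h \<in> \<mm>" for h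
  proof -
    obtain i' j' where ij: "i' \<in> I" "j' \<in> J" "h * x = i' + j'" using split[OF h] by blast
    have a: "a = f * x - i" using ia(3) by simp
    have "h * a - j' * f = f * (h * x) - h * i - j' * f" unfolding a by (simp add: algebra_simps)
    also have "\<dots> = f * i' - h * i" by (simp add: ij(3) algebra_simps)
    finally have "h * a - j' * f \<in> I"
      using ij(1) ia(1) idl(1) by (simp add: ideals.subspace_diff ideals.subspace_scale)
    moreover have "h * a - j' * f \<in> J"
      using ij(2) ia(2) idl(2) ideal_mult_left ideal_mult_right ideals.subspace_diff by metis
    ultimately show ?thesis using mem_adjoin[OF IJ] by blast
  qed
  ultimately show False using ns unfolding has_socle_def by blast
qed

text \<open>
  The other half, by the same reduction: the depth of the cokernel is at least the minimum of the depth
  of the middle term and one less than the depth of the kernel.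
\<close>

lemma depth_ge_sum:
  assumes "admissible I" "admissible J" "depth_ge k I" "depth_ge k J"
    "depth_ge (Suc k) (I \<inter> J)"
  shows "depth_ge k (ideals.span (I \<union> J))"
  using assms
proof (induction k arbitrary: I J)
  case (Suc k)
  have ns: "\<not> has_socle (ideals.span (I \<union> J))"
    using Suc.prems depth_ge_antimono[of _ _ "Suc 0"] depth_ge_antimono[of _ _ "Suc (Suc 0)"]
    by (intro no_socle_sum) auto
  then have "\<exists>f\<in>\<mm>. \<forall>J\<in>{I, J, ideals.span (I \<union> J)}. nonzerodivisor_mod J f"
    using Suc.prems depth_ge_Suc_no_socle admissible_sum by (intro common_nonzerodivisor) blast+
  then obtain f where f: "f \<in> \<mm>" "nonzerodivisor_mod I f" "nonzerodivisor_mod J f"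
    "nonzerodivisor_mod (ideals.span (I \<union> J)) f" by auto
  have "depth_ge (Suc k) (adjoin (I \<inter> J) f)"
    using Suc.prems f admissible_Int nonzerodivisor_mod_Int depth_ge_Suc_iff by blast
  then have "depth_ge (Suc k) (adjoin I f \<inter> adjoin J f)"
    using adjoin_Int[of I J f] Suc.prems(1,2) f(4) by (simp add: admissible_def)
  then have "depth_ge k (ideals.span (adjoin I f \<union> adjoin J f))"
    using Suc.prems f depth_ge_Suc_iff by (intro Suc.IH) (simp_all only: admissible_adjoin)
  then show ?case unfolding span_adjoin_Un
    using f(1,4) by auto
qed simp

definition depth_eq :: "'a set \<Rightarrow> nat \<Rightarrow> bool" where
  "depth_eq J d \<longleftrightarrow> depth_ge d J \<and> \<not> depth_ge (Suc d) J"

lemma depth_eq_adjoin_iff: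
  assumes "admissible J" "f \<in> \<mm>" "nonzerodivisor_mod J f"
  shows "depth_eq J (Suc d) \<longleftrightarrow> depth_eq (adjoin J f) d"
  unfolding depth_eq_def depth_ge_Suc_iff[OF assms] ..

text \<open>
  If the cokernel has smaller depth than the middle term, the two inequalities above determine the
  depth of the kernel.
\<close>

lemma depth_eq_Int:
  assumes "admissible I" "admissible J" "depth_ge (Suc d) I" "depth_ge (Suc d) J"
    "depth_eq (ideals.span (I \<union> J)) d"
  shows "depth_eq (I \<inter> J) (Suc d)"
  unfolding depth_eq_def
  using assms depth_ge_Int[of I J d] depth_ge_sum[of I J "Suc d"] unfolding depth_eq_def by blast

lemma depth_eq_m: "depth_eq \<mm> 0"
  unfolding depth_eq_def using depth_ge_Suc_no_socle[of 0 \<mm>] one_notin_m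
  by (auto simp: has_socle_def intro: ideal_mult_right[OF ideal_m])

end

section \<open>Polynomials and their monomials\<close>

lemma poly_mapping_sum_single: "f = (\<Sum>t\<in>Poly_Mapping.keys f. Poly_Mapping.single t (Poly_Mapping.lookup f t))"
  by (rule poly_mapping_eqI) (simp add: lookup_sum lookup_single when_def in_keys_iff)

lemma keys_add_nat: "Poly_Mapping.keys (s + t) = Poly_Mapping.keys s \<union> Poly_Mapping.keys (t :: 'i \<Rightarrow>\<^sub>0 nat)"
  by (auto simp: in_keys_iff lookup_add)

lemma keys_sum_nat:
  "finite A \<Longrightarrow> Poly_Mapping.keys (\<Sum>x\<in>A. f x :: 'i \<Rightarrow>\<^sub>0 nat) = (\<Union>x\<in>A. Poly_Mapping.keys (f x))"
  by (induction A rule: finite_induct) (auto simp: keys_add_nat)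

lemma split_off_variable:
  assumes "v \<in> Poly_Mapping.keys (t :: 'i \<Rightarrow>\<^sub>0 nat)"
  obtains s where "t = Poly_Mapping.single v 1 + s"
proof
  show "t = Poly_Mapping.single v 1 + (t - Poly_Mapping.single v 1)"
    using assms
    by (intro poly_mapping_eqI) (auto simp: lookup_add lookup_minus lookup_single when_def in_keys_iff)
qed

lemma single_split_variable:
  "Poly_Mapping.single (Poly_Mapping.single v 1 + s) c = Poly_Mapping.single s c * var v"
  by (simp add: var_def mult_single add.commute)

lemma monomial_induct [case_names zero add]:
  assumes "P 0" "\<And>v s. P s \<Longrightarrow> P (Poly_Mapping.single v 1 + s)"
  shows "P (t :: 'i \<Rightarrow>\<^sub>0 nat)"
proof (induction "\<Sum>v\<in>Poly_Mapping.keys t. Poly_Mapping.lookup t v" arbitrary: t rule: less_induct)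
  case less
  show ?case
  proof (cases "t = 0")
    case False
    then obtain v where v: "v \<in> Poly_Mapping.keys t" using keys_eq_empty by blast
    obtain s where s: "t = Poly_Mapping.single v 1 + s" using split_off_variable[OF v] .
    have "(\<Sum>u\<in>Poly_Mapping.keys s. Poly_Mapping.lookup s u) =
        (\<Sum>u\<in>Poly_Mapping.keys t. Poly_Mapping.lookup s u)"
      by (intro sum.mono_neutral_left) (auto simp: s keys_add_nat in_keys_iff)
    also have "\<dots> < (\<Sum>u\<in>Poly_Mapping.keys t. Poly_Mapping.lookup t u)"
    proof (rule sum_strict_mono_ex1)
      have "Poly_Mapping.lookup s v < Poly_Mapping.lookup t v" by (simp add: s lookup_add)
      then show "\<exists>u\<in>Poly_Mapping.keys t. Poly_Mapping.lookup s u < Poly_Mapping.lookup t u"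
        using v by blast
    qed (auto simp: s lookup_add)
    finally show ?thesis unfolding s by (intro assms(2) less) (simp add: s)
  qed (simp add: assms(1))
qed

lemma lookup_sum_single:
  assumes "finite A"
  shows "Poly_Mapping.lookup (\<Sum>t\<in>A. Poly_Mapping.single t (c t)) s = (if s \<in> A then c s else 0)"
  using assms by (simp add: lookup_sum lookup_single when_def)

lemma single_times_sum:
  "Poly_Mapping.single s c * f =
     (\<Sum>t\<in>Poly_Mapping.keys f. Poly_Mapping.single (s + t) (c * Poly_Mapping.lookup f t))"
  by (subst poly_mapping_sum_single[of f]) (simp add: sum_distrib_left mult_single)

lemma lookup_single_times:
  fixes s t :: "'a::cancel_comm_monoid_add"
  shows "Poly_Mapping.lookup (Poly_Mapping.single s c * f) (s + t) = c * Poly_Mapping.lookup f t"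
  unfolding single_times_sum
  by (simp add: lookup_sum lookup_single when_def in_keys_iff)

lemma keys_single_times_subset:
  "Poly_Mapping.keys (Poly_Mapping.single s c * f) \<subseteq> (+) s ` Poly_Mapping.keys f"
  using Poly_Mapping.keys_mult[of "Poly_Mapping.single s c" f] by (auto split: if_splits)

definition monomials_in :: "'i set \<Rightarrow> ('i \<Rightarrow>\<^sub>0 nat) set" where
  "monomials_in I = {t. Poly_Mapping.keys t \<subseteq> I}"

text \<open>
  The substitution of \<open>0\<close> for the variables outside \<open>I\<close>. As a map on coefficients it is visibly
  linear; that it is a ring homomorphism is shown in \<open>restrict_vars_mult\<close>.
\<close>

definition restrict_vars :: "'i set \<Rightarrow> ('i, 'k::comm_ring_1) mpoly \<Rightarrow> ('i, 'k) mpoly" where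
  "restrict_vars I f =
     (\<Sum>t\<in>Poly_Mapping.keys f \<inter> monomials_in I. Poly_Mapping.single t (Poly_Mapping.lookup f t))"

definition polys_in :: "'i set \<Rightarrow> ('i, 'k::comm_ring_1) mpoly set" where
  "polys_in I = {f. Poly_Mapping.keys f \<subseteq> monomials_in I}"

text \<open>
  The ideal generated by the variables outside \<open>I\<close>, described by its monomials
  (\<open>vars_outside_ideal_eq_span\<close>).
\<close>

definition vars_outside_ideal :: "'i set \<Rightarrow> ('i, 'k::comm_ring_1) mpoly set" where
  "vars_outside_ideal I = {f. Poly_Mapping.keys f \<inter> monomials_in I = {}}"

lemma lookup_restrict_vars:
  "Poly_Mapping.lookup (restrict_vars I f) t = (if t \<in> monomials_in I then Poly_Mapping.lookup f t else 0)"
  unfolding restrict_vars_def by (simp add: lookup_sum_single in_keys_iff)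

lemma keys_restrict_vars: "Poly_Mapping.keys (restrict_vars I f) = Poly_Mapping.keys f \<inter> monomials_in I"
  by (auto simp: in_keys_iff lookup_restrict_vars split: if_splits)

lemma add_in_monomials_iff: "s + t \<in> monomials_in I \<longleftrightarrow> s \<in> monomials_in I \<and> t \<in> monomials_in I"
  by (auto simp: monomials_in_def keys_add_nat)

lemma ideal_vars_outside: "ideals.subspace (vars_outside_ideal I)"
proof (rule ideals.subspaceI)
  show "f + g \<in> vars_outside_ideal I"
    if "f \<in> vars_outside_ideal I" "g \<in> vars_outside_ideal I" for f g :: "('a, 'b) mpoly"
    using that Poly_Mapping.keys_add[of f g] by (auto simp: vars_outside_ideal_def)
  show "c * f \<in> vars_outside_ideal I" if "f \<in> vars_outside_ideal I" for c f :: "('a, 'b) mpoly"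
    using that Poly_Mapping.keys_mult[of c f]
    by (fastforce simp: vars_outside_ideal_def add_in_monomials_iff)
qed (simp add: vars_outside_ideal_def)

lemma vars_outside_ideal_eq_span:
  "vars_outside_ideal I = (ideals.span (var ` (- I)) :: ('i, 'k::comm_ring_1) mpoly set)"
proof
  show "ideals.span (var ` (- I)) \<subseteq> (vars_outside_ideal I :: ('i, 'k) mpoly set)"
    by (intro ideals.span_minimal ideal_vars_outside)
       (auto simp: vars_outside_ideal_def monomials_in_def var_def)
  show "vars_outside_ideal I \<subseteq> (ideals.span (var ` (- I)) :: ('i, 'k) mpoly set)"
  proof
    fix f :: "('i, 'k) mpoly" assume f: "f \<in> vars_outside_ideal I"
    have "Poly_Mapping.single t (Poly_Mapping.lookup f t) \<in> ideals.span (var ` (- I))"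
      if "t \<in> Poly_Mapping.keys f" for t
    proof -
      have "t \<notin> monomials_in I" using f that by (auto simp: vars_outside_ideal_def)
      then obtain v where v: "v \<in> Poly_Mapping.keys t" "v \<notin> I" by (auto simp: monomials_in_def)
      obtain s where "t = Poly_Mapping.single v 1 + s" using split_off_variable[OF v(1)] .
      then show ?thesis
        using v(2) by (simp only: single_split_variable) (intro ideals.span_scale ideals.span_base, blast)
    qed
    then show "f \<in> ideals.span (var ` (- I))"
      by (subst poly_mapping_sum_single[of f]) (rule ideals.span_sum)
  qed
qed

lemma polys_in_mult: "f \<in> polys_in I \<Longrightarrow> g \<in> polys_in I \<Longrightarrow> f * g \<in> polys_in I"
  using Poly_Mapping.keys_mult[of f g] by (fastforce simp: polys_in_def add_in_monomials_iff)

lemma polys_in_add: "f \<in> polys_in I \<Longrightarrow> g \<in> polys_in I \<Longrightarrow> f + g \<in> polys_in I"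
  using Poly_Mapping.keys_add[of f g] by (auto simp: polys_in_def)

lemma polys_in_diff: "f \<in> polys_in I \<Longrightarrow> g \<in> polys_in I \<Longrightarrow> f - g \<in> polys_in I"
  using Poly_Mapping.keys_diff[of f g] by (auto simp: polys_in_def)

lemma restrict_vars_in: "restrict_vars I f \<in> polys_in I"
  by (auto simp: polys_in_def keys_restrict_vars)

lemma restrict_vars_id: "f \<in> polys_in I \<Longrightarrow> restrict_vars I f = f"
  by (intro poly_mapping_eqI) (auto simp: lookup_restrict_vars polys_in_def in_keys_iff)

lemma restrict_vars_eq_0_iff: "restrict_vars I f = 0 \<longleftrightarrow> f \<in> vars_outside_ideal I"
  by (auto simp: poly_mapping_eq_iff fun_eq_iff lookup_restrict_vars vars_outside_ideal_def in_keys_iff)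

lemma restrict_vars_add: "restrict_vars I (f + g) = restrict_vars I f + restrict_vars I g"
  by (rule poly_mapping_eqI) (simp add: lookup_restrict_vars lookup_add)

lemma restrict_vars_diff: "restrict_vars I (f - g) = restrict_vars I f - restrict_vars I g"
  by (rule poly_mapping_eqI) (simp add: lookup_restrict_vars lookup_minus)

lemma diff_restrict_vars: "f - restrict_vars I f \<in> vars_outside_ideal I"
  by (simp add: restrict_vars_eq_0_iff[symmetric] restrict_vars_diff restrict_vars_id[OF restrict_vars_in])

lemma restrict_vars_mult: "restrict_vars I (f * g) = restrict_vars I f * restrict_vars I g"
proof -
  let ?r = "restrict_vars I"
  have "f * g - ?r f * ?r g = f * (g - ?r g) + ?r g * (f - ?r f)" by (simp add: algebra_simps)
  also have "\<dots> \<in> vars_outside_ideal I"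
    using diff_restrict_vars ideal_vars_outside ideals.subspace_add ideals.subspace_scale by metis
  finally have "?r (f * g - ?r f * ?r g) = 0" by (simp only: restrict_vars_eq_0_iff)
  then show ?thesis
    by (simp add: restrict_vars_diff restrict_vars_id polys_in_mult restrict_vars_in)
qed

lemma restrict_vars_var: "restrict_vars I (var x) = (if x \<in> I then var x else 0)"
proof (cases "x \<in> I")
  case True
  then show ?thesis by (simp add: restrict_vars_id polys_in_def monomials_in_def var_def)
next
  case False
  then show ?thesis
    by (simp add: restrict_vars_eq_0_iff vars_outside_ideal_def monomials_in_def var_def)
qed

section \<open>Dickson's lemma and Hilbert's basis theorem\<close>

lemma nondecreasing_subsequence:
  fixes s :: "nat \<Rightarrow> nat"
  shows "\<exists>r. strict_mono r \<and> incseq (s \<circ> r)"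
proof -
  obtain r where r: "strict_mono r" "monoseq (\<lambda>n. s (r n))" using seq_monosub by blast
  show ?thesis
  proof (cases "incseq (\<lambda>n. s (r n))")
    case False
    then have dec: "decseq (\<lambda>n. s (r n))" using r(2) by (simp add: monoseq_iff)
    obtain N where N: "\<And>n. s (r N) \<le> s (r n)"
      using ex_has_least_nat[of "\<lambda>_. True" 0 "\<lambda>n. s (r n)"] by auto
    have "s (r (N + n)) = s (r N)" for n
      using N[of "N + n"] dec by (simp add: decseq_def antisym)
    then have "incseq (s \<circ> (\<lambda>n. r (N + n)))" by (simp add: incseq_def)
    moreover have "strict_mono (\<lambda>n. r (N + n))" using r(1) by (simp add: strict_mono_def)
    ultimately show ?thesis by blast
  qed (use r in \<open>auto simp: comp_def\<close>)
qed

lemma dickson_subsequence: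
  fixes t :: "nat \<Rightarrow> 'i \<Rightarrow>\<^sub>0 nat"
  assumes "finite I"
  shows "\<exists>r. strict_mono r \<and> (\<forall>k\<in>I. incseq (\<lambda>n. Poly_Mapping.lookup (t (r n)) k))"
  using assms
proof (induction I)
  case empty
  have "strict_mono (\<lambda>n::nat. n)" by (simp add: strict_mono_def)
  then show ?case by blast
next
  case (insert i I)
  then obtain r where r: "strict_mono r" "\<And>k. k \<in> I \<Longrightarrow> incseq (\<lambda>n. Poly_Mapping.lookup (t (r n)) k)"
    by auto
  obtain q where q: "strict_mono q" "incseq ((\<lambda>n. Poly_Mapping.lookup (t (r n)) i) \<circ> q)"
    using nondecreasing_subsequence by blast
  have "strict_mono (r \<circ> q)" using r(1) q(1) by (simp add: strict_mono_o)
  moreover have "incseq (\<lambda>n. Poly_Mapping.lookup (t ((r \<circ> q) n)) k)" if "k \<in> insert i I" for k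
  proof (cases "k = i")
    case True
    then show ?thesis using q(2) by (simp add: comp_def)
  next
    case False
    then have "k \<in> I" using that by blast
    from r(2)[OF this] show ?thesis
      using strict_mono_mono[OF q(1)] by (auto simp: incseq_def mono_def)
  qed
  ultimately show ?case by blast
qed

definition mono_dvd :: "('i \<Rightarrow>\<^sub>0 nat) \<Rightarrow> ('i \<Rightarrow>\<^sub>0 nat) \<Rightarrow> bool" where
  "mono_dvd s t \<longleftrightarrow> (\<forall>k. Poly_Mapping.lookup s k \<le> Poly_Mapping.lookup t k)"

lemma mono_dvd_cancel: "mono_dvd s t \<Longrightarrow> (t - s) + s = t"
  by (rule poly_mapping_eqI) (simp add: mono_dvd_def lookup_add lookup_minus)

text \<open>
  In a subsequence along which all exponents are nondecreasing, each term divides the next one.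
\<close>

lemma dickson:
  fixes t :: "nat \<Rightarrow> 'i \<Rightarrow>\<^sub>0 nat"
  assumes "finite I" "\<And>n. t n \<in> monomials_in I"
  shows "\<exists>i j. i < j \<and> mono_dvd (t i) (t j)"
proof -
  obtain r where r: "strict_mono r" "\<forall>k\<in>I. incseq (\<lambda>n. Poly_Mapping.lookup (t (r n)) k)"
    using dickson_subsequence[OF assms(1)] by blast
  have "Poly_Mapping.lookup (t (r 0)) k \<le> Poly_Mapping.lookup (t (r 1)) k" for k
  proof (cases "k \<in> I")
    case True
    then show ?thesis using r(2) by (simp add: incseq_def)
  next
    case False
    then have "k \<notin> Poly_Mapping.keys (t (r 0))" using assms(2)[of "r 0"] by (auto simp: monomials_in_def)
    then show ?thesis by (simp add: in_keys_iff)
  qed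
  moreover have "r 0 < r 1" using r(1) by (simp add: strict_mono_def)
  ultimately show ?thesis unfolding mono_dvd_def by blast
qed

lemma zero_le_monomial: "0 \<le> (t :: 'i::linorder \<Rightarrow>\<^sub>0 nat)"
proof (rule ccontr)
  assume "\<not> 0 \<le> t"
  then have "t < 0" by simp
  then show False by (auto simp: less_poly_mapping.rep_eq less_fun_def)
qed

lemma mono_dvd_le: "mono_dvd s t \<Longrightarrow> s \<le> (t :: 'i::linorder \<Rightarrow>\<^sub>0 nat)"
  using add_right_mono[OF zero_le_monomial[of "t - s"], of s] mono_dvd_cancel[of s t] by simp

text \<open>
  Divisibility implies the lexicographic order, so by Dickson's lemma an infinite descending chain is
  impossible as soon as only finitely many variables occur.
\<close>

lemma wf_monomials:
  assumes "finite I"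
  shows "wf {(s, t :: 'i::linorder \<Rightarrow>\<^sub>0 nat). s \<in> monomials_in I \<and> t \<in> monomials_in I \<and> s < t}"
  unfolding wf_iff_no_infinite_down_chain
proof
  assume "\<exists>t. \<forall>n. (t (Suc n), t n) \<in> {(s, t :: 'i \<Rightarrow>\<^sub>0 nat). s \<in> monomials_in I \<and> t \<in> monomials_in I \<and> s < t}"
  then obtain t :: "nat \<Rightarrow> 'i \<Rightarrow>\<^sub>0 nat" where t: "\<And>n. t n \<in> monomials_in I" "\<And>n. t (Suc n) < t n" by auto
  obtain i j where ij: "i < j" "mono_dvd (t i) (t j)" using dickson[OF assms t(1)] by blast
  have "t j < t i" using ij(1) by (induction rule: less_Suc_induct) (auto intro: t(2) less_trans)
  then show False using mono_dvd_le[OF ij(2)] by simp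
qed

lemma minimal_monomials:
  fixes M :: "('i::linorder \<Rightarrow>\<^sub>0 nat) set"
  assumes I: "finite I" and M: "M \<subseteq> monomials_in I"
  shows "\<exists>B\<subseteq>M. finite B \<and> (\<forall>m\<in>M. \<exists>b\<in>B. mono_dvd b m)"
proof (intro exI conjI ballI)
  let ?B = "{m \<in> M. \<forall>m'\<in>M. mono_dvd m' m \<longrightarrow> m' = m}"
  show "?B \<subseteq> M" by blast
  show "finite ?B"
  proof (rule ccontr)
    assume "infinite ?B"
    then obtain t :: "nat \<Rightarrow> 'i \<Rightarrow>\<^sub>0 nat" where t: "inj t" "range t \<subseteq> ?B"
      using infinite_countable_subset by blast
    then obtain i j where "i < j" "mono_dvd (t i) (t j)"
      using dickson[OF I, of t] M by blast
    moreover have "t i \<in> ?B" "t j \<in> ?B" using t(2) by auto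
    ultimately show False using t(1) by (auto simp: inj_def)
  qed
  fix m assume m: "m \<in> M"
  let ?D = "{m' \<in> M. mono_dvd m' m}"
  have "m \<in> ?D" using m by (simp add: mono_dvd_def)
  then obtain b where b: "b \<in> ?D"
    "\<And>y. (y, b) \<in> {(s, t). s \<in> monomials_in I \<and> t \<in> monomials_in I \<and> s < t} \<Longrightarrow> y \<notin> ?D"
    using wfE_min[OF wf_monomials[OF I], of m ?D] by blast
  have "b \<in> ?B"
  proof (clarsimp, intro conjI ballI impI)
    show "b \<in> M" using b(1) by simp
    fix m' assume m': "m' \<in> M" "mono_dvd m' b"
    then have "mono_dvd m' m" using b(1) unfolding mono_dvd_def by (auto intro: order_trans)
    then have "\<not> m' < b" using b m' M by blast
    then show "m' = b" using mono_dvd_le[OF m'(2)] by simp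
  qed
  then show "\<exists>b\<in>?B. mono_dvd b m" using b(1) by blast
qed

text \<open>
  By Dickson's lemma finitely many of the leading monomials of the elements of \<open>A\<close> in the variables of
  \<open>I\<close> divide all the others. Polynomials with these leading monomials generate \<open>A\<close> modulo the
  remaining variables, by division along the lexicographic order.
\<close>

theorem hilbert_basis:
  fixes A :: "('i::linorder, 'k::field) mpoly set"
  assumes I: "finite I" and A: "ideals.subspace A" "vars_outside_ideal I \<subseteq> A"
  shows "\<exists>F. finite F \<and> A = ideals.span (F \<union> vars_outside_ideal I)"
proof -
  define lm :: "('i, 'k) mpoly \<Rightarrow> ('i \<Rightarrow>\<^sub>0 nat)" where "lm f = Max (Poly_Mapping.keys f)" for f
  define P where "P = {f \<in> A. f \<in> polys_in I \<and> f \<noteq> 0}"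
  have lm_in: "lm f \<in> Poly_Mapping.keys f" if "f \<noteq> 0" for f
    unfolding lm_def using that by (intro Max_in) auto
  have le_lm: "s \<le> lm f" if "s \<in> Poly_Mapping.keys f" for s f
    unfolding lm_def using that by simp
  have lmP: "lm ` P \<subseteq> monomials_in I" using lm_in by (auto simp: P_def polys_in_def)
  obtain B where B: "B \<subseteq> lm ` P" "finite B" "\<forall>m\<in>lm ` P. \<exists>b\<in>B. mono_dvd b m"
    using minimal_monomials[OF I lmP] by blast
  obtain F where F: "F \<subseteq> P" "finite F" "B = lm ` F"
    using finite_subset_image[OF B(2,1)] by blast
  let ?S = "ideals.span (F \<union> vars_outside_ideal I)"
  have reduce: "f \<in> ?S" if "f \<in> P" "lm f = m" for f m
    using that
  proof (induction m arbitrary: f rule: wf_induct_rule[OF wf_monomials[OF I]])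
    case (1 m)
    obtain g where g: "g \<in> F" "mono_dvd (lm g) m" using B(3) F(3) 1(2,3) by auto
    define u where "u = m - lm g"
    have u: "u + lm g = m" unfolding u_def by (rule mono_dvd_cancel[OF g(2)])
    have gP: "g \<in> P" using g(1) F(1) by blast
    \<comment> \<open>the multiple \<open>h\<close> of \<open>g\<close> has the same leading term as \<open>f\<close>\<close>
    define c where "c = Poly_Mapping.lookup f m / Poly_Mapping.lookup g (lm g)"
    define h where "h = Poly_Mapping.single u c * g"
    have gne: "Poly_Mapping.lookup g (lm g) \<noteq> 0"
      using gP lm_in[of g] by (simp add: P_def in_keys_iff)
    have "Poly_Mapping.lookup h m = Poly_Mapping.lookup f m"
      unfolding h_def u[symmetric] lookup_single_times using gne by (simp add: c_def u)
    then have z: "m \<notin> Poly_Mapping.keys (f - h)" by (simp add: in_keys_iff lookup_minus)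
    have hk: "s \<le> m" if s: "s \<in> Poly_Mapping.keys h" for s
    proof -
      obtain s' where "s = u + s'" "s' \<in> Poly_Mapping.keys g"
        using s keys_single_times_subset[of u c g] unfolding h_def by blast
      then show ?thesis using le_lm u add_left_mono by metis
    qed
    have m: "m \<in> monomials_in I" using 1(2,3) lmP by blast
    then have "u \<in> monomials_in I" using u add_in_monomials_iff by metis
    then have "Poly_Mapping.single u c \<in> polys_in I" by (simp add: polys_in_def)
    then have hI: "h \<in> polys_in I" unfolding h_def using gP by (auto simp: P_def intro: polys_in_mult)
    have hA: "h \<in> A" unfolding h_def using gP A(1) by (auto simp: P_def intro: ideals.subspace_scale)
    have "f - h \<in> ?S"
    proof (cases "f - h = 0")
      case False
      then have fhP: "f - h \<in> P"
        using 1(2) hI hA A(1) by (auto simp: P_def intro: polys_in_diff ideals.subspace_diff)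
      have k: "lm (f - h) \<in> Poly_Mapping.keys (f - h)" by (rule lm_in[OF False])
      then have "lm (f - h) \<le> m"
        using Poly_Mapping.keys_diff[of f h] le_lm[of _ f] 1(3) hk by auto
      then have "lm (f - h) < m" using k z by (auto simp: less_le)
      then show ?thesis using 1(1)[OF _ fhP refl] lmP fhP m by auto
    qed (simp only: ideals.span_zero)
    moreover have "h \<in> ?S"
      unfolding h_def using g(1) by (intro ideals.span_scale ideals.span_base) blast
    ultimately have "(f - h) + h \<in> ?S" by (rule ideals.span_add)
    then show ?case by simp
  qed
  have "A \<subseteq> ?S"
  proof
    fix f assume f: "f \<in> A"
    let ?r = "restrict_vars I f"
    have "?r = f - (f - ?r)" by simp
    also have "\<dots> \<in> A" using A diff_restrict_vars f ideals.subspace_diff by blast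
    finally have "?r \<in> A" .
    then have "?r \<in> ?S"
      using reduce[of ?r] restrict_vars_in[of I f] ideals.span_zero by (cases "?r = 0") (auto simp: P_def)
    moreover have "f - ?r \<in> ?S" using diff_restrict_vars ideals.span_base by blast
    ultimately have "?r + (f - ?r) \<in> ?S" by (rule ideals.span_add)
    then show "f \<in> ?S" by simp
  qed
  moreover have "?S \<subseteq> A"
    using A F(1) by (intro ideals.span_minimal) (auto simp: P_def)
  ultimately show ?thesis using F(2) by blast
qed

definition max_ideal :: "('i, 'k::comm_ring_1) mpoly set" where
  "max_ideal = {f. Poly_Mapping.lookup f 0 = 0}"

lemma max_ideal_eq: "max_ideal = vars_outside_ideal {}"
  by (auto simp: max_ideal_def vars_outside_ideal_def monomials_in_def in_keys_iff)

lemma ideal_max: "ideals.subspace max_ideal"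
  unfolding max_ideal_eq by (rule ideal_vars_outside)

lemma var_in_max_ideal: "var v \<in> max_ideal"
proof -
  have "Poly_Mapping.single v (1::nat) \<noteq> 0" by (metis keys_eq_empty keys_single insert_not_empty one_neq_zero)
  then show ?thesis by (simp add: max_ideal_def var_def lookup_single when_def)
qed

lemma noetherian_over_polys:
  assumes "finite (I :: 'i::linorder set)"
  shows "noetherian_over (max_ideal :: ('i, 'k::field) mpoly set) (vars_outside_ideal I)"
proof
  show "ideals.subspace (max_ideal :: ('i, 'k) mpoly set)"
    unfolding max_ideal_eq by (rule ideal_vars_outside)
  show "(1 :: ('i, 'k) mpoly) \<notin> max_ideal" by (simp add: max_ideal_def)
qed (rule hilbert_basis[OF assms])

section \<open>Ideals of Segre products\<close>

text \<open>
  The image of \<open>f\<close> under the map of monoid algebras that is induced by \<open>d\<close> on the exponents.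
\<close>

definition push_monomials :: "('a \<Rightarrow> 'b) \<Rightarrow> ('a \<Rightarrow>\<^sub>0 'k::comm_ring_1) \<Rightarrow> 'b \<Rightarrow>\<^sub>0 'k" where
  "push_monomials d f =
     (\<Sum>t\<in>Poly_Mapping.keys f. Poly_Mapping.single (d t) (Poly_Mapping.lookup f t))"

lemma push_monomials_superset:
  assumes "finite A" "Poly_Mapping.keys f \<subseteq> A"
  shows "push_monomials d f = (\<Sum>t\<in>A. Poly_Mapping.single (d t) (Poly_Mapping.lookup f t))"
  unfolding push_monomials_def using assms
  by (intro sum.mono_neutral_left) (auto simp: in_keys_iff)

lemma push_monomials_0 [simp]: "push_monomials d 0 = 0"
  by (simp add: push_monomials_def)

lemma push_monomials_add: "push_monomials d (f + g) = push_monomials d f + push_monomials d g"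
proof -
  let ?A = "Poly_Mapping.keys f \<union> Poly_Mapping.keys g"
  have "push_monomials d h = (\<Sum>t\<in>?A. Poly_Mapping.single (d t) (Poly_Mapping.lookup h t))"
    if "h \<in> {f, g, f + g}" for h
    using that Poly_Mapping.keys_add[of f g] by (intro push_monomials_superset) auto
  then show ?thesis by (simp add: lookup_add single_add sum.distrib)
qed

lemma push_monomials_sum: "push_monomials d (\<Sum>x\<in>A. f x) = (\<Sum>x\<in>A. push_monomials d (f x))"
  by (induction A rule: infinite_finite_induct) (auto simp: push_monomials_add)

lemma push_monomials_diff: "push_monomials d (f - g) = push_monomials d f - push_monomials d g"
  using push_monomials_add[of d "f - g" g] by (simp add: algebra_simps)

lemma push_monomials_single [simp]:
  "push_monomials d (Poly_Mapping.single t c) = Poly_Mapping.single (d t) c"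
  by (simp add: push_monomials_def)

lemma push_monomials_compose:
  "push_monomials e (push_monomials d f) = push_monomials (\<lambda>t. e (d t)) f"
  by (simp add: push_monomials_def[of d f] push_monomials_sum push_monomials_def[of "\<lambda>t. e (d t)" f])

lemma push_monomials_mult:
  assumes "\<And>s t. d (s + t) = d s + (d t :: 'b::comm_monoid_add)"
  shows "push_monomials d (f * g) = push_monomials d f * push_monomials d g"
proof -
  have "f * g = (\<Sum>s\<in>Poly_Mapping.keys f. \<Sum>t\<in>Poly_Mapping.keys g.
      Poly_Mapping.single (s + t) (Poly_Mapping.lookup f s * Poly_Mapping.lookup g t))"
    by (subst poly_mapping_sum_single[of f], subst poly_mapping_sum_single[of g])
       (simp add: sum_product mult_single)
  then show ?thesis
    unfolding push_monomials_def[of d f] push_monomials_def[of d g]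
    by (simp add: push_monomials_sum sum_product mult_single assms)
qed

lemma keys_push_monomials: "Poly_Mapping.keys (push_monomials d f) \<subseteq> d ` Poly_Mapping.keys f"
  unfolding push_monomials_def
  using Poly_Mapping.keys_sum[of "\<lambda>t. Poly_Mapping.single (d t) (Poly_Mapping.lookup f t)" "Poly_Mapping.keys f"]
  by (auto split: if_splits)

lemma lookup_push_monomials:
  "Poly_Mapping.lookup (push_monomials d f) u =
     (\<Sum>t | t \<in> Poly_Mapping.keys f \<and> d t = u. Poly_Mapping.lookup f t)"
  unfolding push_monomials_def
  by (simp add: lookup_sum lookup_single when_def sum.If_cases Int_def)

text \<open>
  The variables \<open>x\<^sub>i\<^sub>k\<close> are arranged in blocks by the map \<open>blk\<close> on the column indices \<open>k\<close>. There is one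
  new variable for each pair of a row and a block (\<open>Inl\<close>) and one for each column (\<open>Inr\<close>);
  \<open>segre_degree\<close> is the exponent map of the substitution that sends \<open>x\<^sub>i\<^sub>k\<close> to the product of the
  variables of \<open>(i, blk k)\<close> and of \<open>k\<close>.
\<close>

definition segre_degree :: "(nat \<Rightarrow> 'c) \<Rightarrow> (nat \<times> nat \<Rightarrow>\<^sub>0 nat) \<Rightarrow> ((nat \<times> 'c) + nat \<Rightarrow>\<^sub>0 nat)" where
  "segre_degree blk t =
     (\<Sum>(i, k)\<in>Poly_Mapping.keys t. Poly_Mapping.single (Inl (i, blk k)) (Poly_Mapping.lookup t (i, k)) +
        Poly_Mapping.single (Inr k) (Poly_Mapping.lookup t (i, k)))"

lemma segre_degree_add: "segre_degree blk (s + t) = segre_degree blk s + segre_degree blk t"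
proof -
  let ?A = "Poly_Mapping.keys s \<union> Poly_Mapping.keys t"
  have "segre_degree blk u =
     (\<Sum>(i, k)\<in>?A. Poly_Mapping.single (Inl (i, blk k)) (Poly_Mapping.lookup u (i, k)) +
        Poly_Mapping.single (Inr k) (Poly_Mapping.lookup u (i, k)))"
    if "u \<in> {s, t, s + t}" for u
    unfolding segre_degree_def using that
    by (intro sum.mono_neutral_left) (auto simp: keys_add_nat in_keys_iff)
  then show ?thesis
    by (simp add: lookup_add single_add sum.distrib split_def algebra_simps)
qed

lemma keys_segre_degree:
  "Poly_Mapping.keys (segre_degree blk t) = (\<Union>(i, k)\<in>Poly_Mapping.keys t. {Inl (i, blk k), Inr k})"
  unfolding segre_degree_def
  by (subst keys_sum_nat) (auto simp: keys_add_nat in_keys_iff)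

lemma segre_degree_single:
  "segre_degree blk (Poly_Mapping.single (i, k) (Suc 0)) =
     Poly_Mapping.single (Inl (i, blk k)) (Suc 0) + Poly_Mapping.single (Inr k) (Suc 0)"
  by (simp add: segre_degree_def)

text \<open>
  The kernel of the above substitution after all new variables outside \<open>N\<close> are set to \<open>0\<close>. Within each
  block it is the ideal of the Segre product of the projective spaces on the rows and on the columns in
  \<open>N\<close>, together with the variables whose row or column is not in \<open>N\<close>. A set \<open>N\<close> of rows and columns describes the ideal better than a set of variables \<open>x\<^sub>i\<^sub>k\<close>:
  setting a row or a column to zero just removes an element.
\<close>

definition segre_ideal ::
    "(nat \<Rightarrow> 'c) \<Rightarrow> ((nat \<times> 'c) + nat) set \<Rightarrow> (nat \<times> nat, 'k::comm_ring_1) mpoly set" where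
  "segre_ideal blk N = {f. push_monomials (segre_degree blk) f \<in> vars_outside_ideal N}"

lemma segre_idealI:
  assumes "\<And>t. t \<in> Poly_Mapping.keys f \<Longrightarrow> \<not> Poly_Mapping.keys (segre_degree blk t) \<subseteq> N"
  shows "f \<in> segre_ideal blk N"
  using assms keys_push_monomials[of "segre_degree blk" f]
  by (auto simp: segre_ideal_def vars_outside_ideal_def monomials_in_def)

lemma ideal_segre: "ideals.subspace (segre_ideal blk N)"
  by (rule ideals.subspaceI)
     (auto simp: segre_ideal_def push_monomials_add push_monomials_mult segre_degree_add
       intro: ideals.subspace_0 ideals.subspace_add ideals.subspace_scale ideal_vars_outside)

lemma segre_ideal_antimono: "M \<subseteq> N \<Longrightarrow> segre_ideal blk N \<subseteq> segre_ideal blk M"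
  by (auto simp: segre_ideal_def vars_outside_ideal_def monomials_in_def)

lemma segre_ideal_le_max: "(segre_ideal blk N :: (nat \<times> nat, 'k::comm_ring_1) mpoly set) \<subseteq> max_ideal"
proof
  fix f :: "(nat \<times> nat, 'k) mpoly" assume "f \<in> segre_ideal blk N"
  then have "0 \<notin> Poly_Mapping.keys (push_monomials (segre_degree blk) f)"
    by (auto simp: segre_ideal_def vars_outside_ideal_def monomials_in_def)
  then have "(\<Sum>t | t \<in> Poly_Mapping.keys f \<and> segre_degree blk t = 0. Poly_Mapping.lookup f t) = 0"
    by (simp add: in_keys_iff lookup_push_monomials)
  moreover have "segre_degree blk t = 0 \<longleftrightarrow> t = 0" for t
    using keys_segre_degree[of blk t] by (auto simp: segre_degree_def simp flip: keys_eq_empty)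
  moreover have "{t. t \<in> Poly_Mapping.keys f \<and> t = 0} = (if 0 \<in> Poly_Mapping.keys f then {0} else {})"
    by auto
  ultimately show "f \<in> max_ideal" by (auto simp: max_ideal_def in_keys_iff split: if_splits)
qed

lemma vars_outside_le_segre:
  assumes "\<And>i k. Inl (i, blk k) \<in> N \<Longrightarrow> Inr k \<in> N \<Longrightarrow> (i, k) \<in> I"
  shows "vars_outside_ideal I \<subseteq> (segre_ideal blk N :: (nat \<times> nat, 'k::comm_ring_1) mpoly set)"
proof
  fix f :: "(nat \<times> nat, 'k) mpoly" assume f: "f \<in> vars_outside_ideal I"
  show "f \<in> segre_ideal blk N"
  proof (rule segre_idealI)
    fix t assume "t \<in> Poly_Mapping.keys f"
    then have "t \<notin> monomials_in I" using f by (auto simp: vars_outside_ideal_def)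
    then obtain i k where "(i, k) \<in> Poly_Mapping.keys t" "(i, k) \<notin> I"
      by (auto simp: monomials_in_def)
    then show "\<not> Poly_Mapping.keys (segre_degree blk t) \<subseteq> N"
      using assms[of i k] unfolding keys_segre_degree by blast
  qed
qed

text \<open>
  The image of the variable is a monomial in variables that are not set to \<open>0\<close>.
\<close>

lemma nonzerodivisor_var_segre:
  assumes "Inl (i, blk k) \<in> N" "Inr k \<in> N"
  shows "nonzerodivisor_mod (segre_ideal blk N) (var (i, k) :: (nat \<times> nat, 'k::comm_ring_1) mpoly)"
  unfolding nonzerodivisor_mod_def
proof (intro allI impI)
  fix f :: "(nat \<times> nat, 'k) mpoly"
  let ?p = "push_monomials (segre_degree blk)"
  let ?s = "segre_degree blk (Poly_Mapping.single (i, k) 1)"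
  assume "var (i, k) * f \<in> segre_ideal blk N"
  then have "Poly_Mapping.single ?s 1 * ?p f \<in> vars_outside_ideal N"
    by (simp add: segre_ideal_def var_def push_monomials_mult segre_degree_add)
  moreover have "?s \<in> monomials_in N"
    using assms by (simp add: monomials_in_def keys_segre_degree)
  ultimately have "?s + t \<notin> Poly_Mapping.keys (Poly_Mapping.single ?s 1 * ?p f)"
    if "t \<in> monomials_in N" for t
    using that add_in_monomials_iff[of ?s t N] unfolding vars_outside_ideal_def by blast
  then have "t \<notin> Poly_Mapping.keys (?p f)" if "t \<in> monomials_in N" for t
    using that lookup_single_times[of ?s 1 "?p f" t] unfolding in_keys_iff by simp
  then show "f \<in> segre_ideal blk N" by (auto simp: segre_ideal_def vars_outside_ideal_def)
qed

lemma segre_degree_two_variables: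
  assumes "Inl (i, blk k) \<in> Poly_Mapping.keys (segre_degree blk t)"
    "Inr k \<in> Poly_Mapping.keys (segre_degree blk t)"
    and "(i, k) \<notin> Poly_Mapping.keys t"
  obtains j l r where "blk l = blk k"
    "t = Poly_Mapping.single (i, l) 1 + (Poly_Mapping.single (j, k) 1 + r)"
proof -
  obtain l where l: "(i, l) \<in> Poly_Mapping.keys t" "blk l = blk k"
    using assms(1) by (auto simp: keys_segre_degree)
  obtain j where j: "(j, k) \<in> Poly_Mapping.keys t"
    using assms(2) by (auto simp: keys_segre_degree)
  obtain s where s: "t = Poly_Mapping.single (i, l) 1 + s" using split_off_variable[OF l(1)] .
  have "(j, k) \<in> Poly_Mapping.keys s" using j l assms(3) by (auto simp: s keys_add_nat)
  then obtain r where r: "s = Poly_Mapping.single (j, k) 1 + r" using split_off_variable by metis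
  show thesis using that[OF l(2)] s r by simp
qed

lemma segre_degree_swap:
  assumes "blk l = blk k"
  shows "segre_degree blk (Poly_Mapping.single (i, l) 1 + (Poly_Mapping.single (j, k) 1 + r)) =
         segre_degree blk (Poly_Mapping.single (i, k) 1 + (Poly_Mapping.single (j, l) 1 + r))"
  by (simp add: segre_degree_add segre_degree_single assms ac_simps)

text \<open>
  If row \<open>i\<close> of the block of \<open>k\<close> and column \<open>k\<close> both occur in a degree, some monomial of that degree
  is divisible by \<open>x\<^sub>i\<^sub>k\<close>: rewrite \<open>x\<^sub>i\<^sub>l x\<^sub>j\<^sub>k\<close> as \<open>x\<^sub>i\<^sub>k x\<^sub>j\<^sub>l\<close>.
\<close>

lemma segre_degree_factor_var:
  assumes "Inl (i, blk k) \<in> Poly_Mapping.keys (segre_degree blk t)"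
    "Inr k \<in> Poly_Mapping.keys (segre_degree blk t)"
  shows "\<exists>s. segre_degree blk t = segre_degree blk (Poly_Mapping.single (i, k) 1 + s)"
proof (cases "(i, k) \<in> Poly_Mapping.keys t")
  case True
  then show ?thesis using split_off_variable[of "(i, k)" t] by metis
next
  case False
  then show ?thesis using segre_degree_two_variables[OF assms] segre_degree_swap by metis
qed

text \<open>
  In the image of an element of the intersection, all degrees supported in \<open>N\<close> contain both \<open>a\<close> and
  \<open>b\<close>, so each of them is the degree of a multiple of the variable. Subtracting suitable multiples
  leaves an element of \<open>segre_ideal blk N\<close>.
\<close>

lemma adjoin_var_segre:
  fixes blk :: "nat \<Rightarrow> 'c" and i k :: nat
  defines "a \<equiv> Inl (i, blk k)" and "b \<equiv> Inr k"
  shows "adjoin (segre_ideal blk N) (var (i, k)) =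
         segre_ideal blk (N - {a}) \<inter> (segre_ideal blk (N - {b}) :: (nat \<times> nat, 'k::comm_ring_1) mpoly set)"
proof
  have "(var (i, k) :: (nat \<times> nat, 'k) mpoly) \<in> segre_ideal blk (N - {c})" if "c \<in> {a, b}" for c
    using that by (intro segre_idealI) (auto simp: var_def keys_segre_degree a_def b_def split: if_splits)
  then show "adjoin (segre_ideal blk N) (var (i, k)) \<subseteq>
      segre_ideal blk (N - {a}) \<inter> (segre_ideal blk (N - {b}) :: (nat \<times> nat, 'k) mpoly set)"
    unfolding adjoin_def
    using segre_ideal_antimono[of "N - {a}" N blk] segre_ideal_antimono[of "N - {b}" N blk]
    by (intro Int_greatest ideals.span_minimal ideal_segre) auto
next
  show "segre_ideal blk (N - {a}) \<inter> segre_ideal blk (N - {b}) \<subseteq>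
      (adjoin (segre_ideal blk N) (var (i, k)) :: (nat \<times> nat, 'k) mpoly set)"
  proof
    fix f :: "(nat \<times> nat, 'k) mpoly"
    assume f: "f \<in> segre_ideal blk (N - {a}) \<inter> segre_ideal blk (N - {b})"
    let ?p = "push_monomials (segre_degree blk)"
    define D where "D = Poly_Mapping.keys (?p f) \<inter> monomials_in N"
    \<comment> \<open>\<open>D\<close> consists of the degrees that keep the image of \<open>f\<close> from vanishing\<close>
    have "\<exists>s. u = segre_degree blk (Poly_Mapping.single (i, k) 1 + s)" if u: "u \<in> D" for u
    proof -
      obtain t where t: "u = segre_degree blk t"
        using u keys_push_monomials[of "segre_degree blk" f] by (auto simp: D_def)
      have "a \<in> Poly_Mapping.keys u" "b \<in> Poly_Mapping.keys u"
        using u f by (auto simp: D_def segre_ideal_def vars_outside_ideal_def monomials_in_def)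
      then show ?thesis using segre_degree_factor_var[of i blk k t] by (simp add: t a_def b_def)
    qed
    then obtain s where s: "\<And>u. u \<in> D \<Longrightarrow> segre_degree blk (Poly_Mapping.single (i, k) 1 + s u) = u"
      by metis
    define g where "g = (\<Sum>u\<in>D. Poly_Mapping.single (s u) (Poly_Mapping.lookup (?p f) u))"
    have "?p (g * var (i, k)) = (\<Sum>u\<in>D. Poly_Mapping.single u (Poly_Mapping.lookup (?p f) u))"
      unfolding g_def var_def sum_distrib_right push_monomials_sum
      by (intro sum.cong refl) (use s in \<open>simp add: mult_single add.commute\<close>)
    also have "\<dots> = restrict_vars N (?p f)" by (simp add: restrict_vars_def D_def)
    finally have "?p (f - g * var (i, k)) \<in> vars_outside_ideal N"
      by (simp only: push_monomials_diff diff_restrict_vars)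
    then have "f - g * var (i, k) \<in> segre_ideal blk N" by (simp add: segre_ideal_def)
    then show "f \<in> adjoin (segre_ideal blk N) (var (i, k))"
      using mem_adjoin[OF ideal_segre] by blast
  qed
qed

text \<open>
  An element of the right-hand side splits into the terms whose degree contains \<open>a\<close>, which vanish
  when \<open>a\<close> is set to zero, and the remaining terms, in whose degrees it makes no difference to
  remove \<open>a\<close> as well.
\<close>

lemma sum_segre_ideals:
  "ideals.span (segre_ideal blk (N - {a}) \<union> segre_ideal blk (N - {b})) =
     (segre_ideal blk (N - {a, b}) :: (nat \<times> nat, 'k::comm_ring_1) mpoly set)"
proof
  show "ideals.span (segre_ideal blk (N - {a}) \<union> segre_ideal blk (N - {b})) \<subseteq>
      (segre_ideal blk (N - {a, b}) :: (nat \<times> nat, 'k) mpoly set)"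
    using segre_ideal_antimono[of "N - {a, b}" "N - {a}" blk]
      segre_ideal_antimono[of "N - {a, b}" "N - {b}" blk]
    by (intro ideals.span_minimal ideal_segre) blast
  show "(segre_ideal blk (N - {a, b}) :: (nat \<times> nat, 'k) mpoly set) \<subseteq>
      ideals.span (segre_ideal blk (N - {a}) \<union> segre_ideal blk (N - {b}))"
  proof
    fix f :: "(nat \<times> nat, 'k) mpoly" assume f: "f \<in> segre_ideal blk (N - {a, b})"
    let ?d = "segre_degree blk"
    define A where "A = {t. a \<in> Poly_Mapping.keys (?d t)}"
    define g where "g = (\<Sum>t\<in>Poly_Mapping.keys f \<inter> A. Poly_Mapping.single t (Poly_Mapping.lookup f t))"
    have g: "Poly_Mapping.lookup g t = (if t \<in> A then Poly_Mapping.lookup f t else 0)" for t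
      unfolding g_def by (simp add: lookup_sum_single in_keys_iff)
    have "t \<in> A" if "t \<in> Poly_Mapping.keys g" for t
      using that by (simp add: in_keys_iff g split: if_splits)
    then have "g \<in> segre_ideal blk (N - {a})"
      by (intro segre_idealI) (auto simp: A_def)
    moreover have "f - g \<in> segre_ideal blk (N - {b})"
    proof -
      have "u \<notin> Poly_Mapping.keys (push_monomials ?d (f - g))" if u: "u \<in> monomials_in (N - {b})" for u
      proof
        assume uk: "u \<in> Poly_Mapping.keys (push_monomials ?d (f - g))"
        then obtain t where "t \<in> Poly_Mapping.keys (f - g)" "u = ?d t"
          using keys_push_monomials[of ?d "f - g"] by blast
        then have au: "a \<notin> Poly_Mapping.keys u"
          by (auto simp: in_keys_iff lookup_minus g A_def split: if_splits)
        then have "u \<notin> Poly_Mapping.keys (push_monomials ?d g)"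
          using keys_push_monomials[of ?d g] by (auto simp: in_keys_iff g A_def split: if_splits)
        then have "u \<in> Poly_Mapping.keys (push_monomials ?d f)"
          using uk by (simp add: in_keys_iff push_monomials_diff lookup_minus)
        then show False
          using f u au by (auto simp: segre_ideal_def vars_outside_ideal_def monomials_in_def)
      qed
      then show ?thesis by (auto simp: segre_ideal_def vars_outside_ideal_def)
    qed
    ultimately have "g + (f - g) \<in> ideals.span (segre_ideal blk (N - {a}) \<union> segre_ideal blk (N - {b}))"
      by (intro ideals.span_add) (auto intro: ideals.span_base)
    then show "f \<in> ideals.span (segre_ideal blk (N - {a}) \<union> segre_ideal blk (N - {b}))" by simp
  qed
qed

text \<open>
  When the only row of a block is removed, its columns no longer contribute to the ideal.
\<close>

lemma segre_ideal_drop_last_row: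
  assumes "\<And>j. Inl (j, blk k) \<in> N \<Longrightarrow> j = i"
  shows "(segre_ideal blk (N - {Inr k}) :: (nat \<times> nat, 'k::comm_ring_1) mpoly set) \<subseteq>
         segre_ideal blk (N - {Inl (i, blk k)})"
proof
  fix f :: "(nat \<times> nat, 'k) mpoly" assume f: "f \<in> segre_ideal blk (N - {Inr k})"
  let ?p = "push_monomials (segre_degree blk) f"
  have "u \<notin> monomials_in (N - {Inl (i, blk k)})" if u: "u \<in> Poly_Mapping.keys ?p" for u
  proof
    assume un: "u \<in> monomials_in (N - {Inl (i, blk k)})"
    obtain t where t: "u = segre_degree blk t"
      using u keys_push_monomials[of "segre_degree blk" f] by auto
    have "u \<notin> monomials_in (N - {Inr k})" using f u by (auto simp: segre_ideal_def vars_outside_ideal_def)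
    then have "Inr k \<in> Poly_Mapping.keys u" using un by (auto simp: monomials_in_def)
    then obtain j where "Inl (j, blk k) \<in> Poly_Mapping.keys u" by (auto simp: t keys_segre_degree)
    then show False using un assms by (auto simp: monomials_in_def)
  qed
  then show "f \<in> segre_ideal blk (N - {Inl (i, blk k)})"
    by (auto simp: segre_ideal_def vars_outside_ideal_def)
qed

lemma segre_ideal_drop_last_column:
  assumes "\<And>l. Inr l \<in> N \<Longrightarrow> blk l = blk k \<Longrightarrow> l = k"
  shows "(segre_ideal blk (N - {Inl (i, blk k)}) :: (nat \<times> nat, 'k::comm_ring_1) mpoly set) \<subseteq>
         segre_ideal blk (N - {Inr k})"
proof
  fix f :: "(nat \<times> nat, 'k) mpoly" assume f: "f \<in> segre_ideal blk (N - {Inl (i, blk k)})"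
  let ?p = "push_monomials (segre_degree blk) f"
  have "u \<notin> monomials_in (N - {Inr k})" if u: "u \<in> Poly_Mapping.keys ?p" for u
  proof
    assume un: "u \<in> monomials_in (N - {Inr k})"
    obtain t where t: "u = segre_degree blk t"
      using u keys_push_monomials[of "segre_degree blk" f] by auto
    have "u \<notin> monomials_in (N - {Inl (i, blk k)})"
      using f u by (auto simp: segre_ideal_def vars_outside_ideal_def)
    then have "Inl (i, blk k) \<in> Poly_Mapping.keys u" using un by (auto simp: monomials_in_def)
    then obtain l where "(i, l) \<in> Poly_Mapping.keys t" and l: "blk l = blk k"
      by (auto simp: t keys_segre_degree)
    then have "Inr l \<in> Poly_Mapping.keys u" unfolding t keys_segre_degree by blast
    then show False using un assms[of l] l by (auto simp: monomials_in_def)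
  qed
  then show "f \<in> segre_ideal blk (N - {Inr k})"
    by (auto simp: segre_ideal_def vars_outside_ideal_def)
qed

lemma segre_ideal_edgeless:
  assumes "\<And>i k. Inl (i, blk k) \<in> N \<Longrightarrow> Inr k \<notin> N"
  shows "segre_ideal blk N = (max_ideal :: (nat \<times> nat, 'k::comm_ring_1) mpoly set)"
proof
  show "max_ideal \<subseteq> (segre_ideal blk N :: (nat \<times> nat, 'k) mpoly set)"
  proof
    fix f :: "(nat \<times> nat, 'k) mpoly" assume f: "f \<in> max_ideal"
    show "f \<in> segre_ideal blk N"
    proof (rule segre_idealI)
      fix t assume "t \<in> Poly_Mapping.keys f"
      then have "t \<noteq> 0" using f by (auto simp: max_ideal_def in_keys_iff)
      then obtain i k where "(i, k) \<in> Poly_Mapping.keys t" by (metis ex_in_conv keys_eq_empty surj_pair)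
      then show "\<not> Poly_Mapping.keys (segre_degree blk t) \<subseteq> N"
        using assms[of i k] unfolding keys_segre_degree by blast
    qed
  qed
qed (rule segre_ideal_le_max)

abbreviation poly_depth_eq :: "('i, 'k::comm_ring_1) mpoly set \<Rightarrow> nat \<Rightarrow> bool" where
  "poly_depth_eq \<equiv> noetherian_over.depth_eq max_ideal"

text \<open>
  The dimension of the affine cone over the Segre product with \<open>r\<close> rows and \<open>s\<close> columns, for
  one block.
\<close>

definition segre_depth_summand :: "nat \<Rightarrow> nat \<Rightarrow> nat" where
  "segre_depth_summand r s = (if r = 0 \<or> s = 0 then 0 else r + s - 1)"

definition rows_of :: "((nat \<times> 'c) + nat) set \<Rightarrow> 'c \<Rightarrow> nat set" where
  "rows_of N c = {i. Inl (i, c) \<in> N}"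

definition columns_of :: "(nat \<Rightarrow> 'c) \<Rightarrow> ((nat \<times> 'c) + nat) set \<Rightarrow> 'c \<Rightarrow> nat set" where
  "columns_of blk N c = {k. Inr k \<in> N \<and> blk k = c}"

text \<open>
  Induction on \<open>N\<close>. If a block has a row \<open>a\<close> and a column \<open>b\<close>, then adjoining the corresponding
  variable leads to the intersection of the ideals without \<open>a\<close> and without \<open>b\<close>, with the ideal
  without both as their sum. If the block has at least two rows and two columns, the first two depths
  are one less and the last one is two less, as the depth lemma requires; if \<open>a\<close> is the only row or
  \<open>b\<close> the only column, one of the two ideals contains the other and the intersection is simpler.
\<close>

theorem depth_segre_ideal:
  fixes blk :: "nat \<Rightarrow> 'c" and N :: "((nat \<times> 'c) + nat) set" and I :: "(nat \<times> nat) set"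
  assumes "finite I" "finite N" "finite C"
    and "\<And>i k. Inl (i, blk k) \<in> N \<Longrightarrow> Inr k \<in> N \<Longrightarrow> (i, k) \<in> I"
    and "\<And>k. Inr k \<in> N \<Longrightarrow> blk k \<in> C"
  shows "poly_depth_eq (segre_ideal blk N :: (nat \<times> nat, 'k::field) mpoly set)
           (\<Sum>c\<in>C. segre_depth_summand (card (rows_of N c)) (card (columns_of blk N c)))"
  using assms(2,4,5)
proof (induction "card N" arbitrary: N rule: less_induct)
  case less
  interpret noetherian_over "max_ideal :: (nat \<times> nat, 'k) mpoly set" "vars_outside_ideal I"
    by (rule noetherian_over_polys[OF assms(1)])
  let ?J = "\<lambda>N. segre_ideal blk N :: (nat \<times> nat, 'k) mpoly set"
  let ?w = "\<lambda>N c. segre_depth_summand (card (rows_of N c)) (card (columns_of blk N c))"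
  have adm: "admissible (?J M)" if "M \<subseteq> N" for M
    unfolding admissible_def
    using that less.prems(2) by (intro conjI ideal_segre segre_ideal_le_max vars_outside_le_segre) blast
  have fin: "finite (rows_of N c)" "finite (columns_of blk N c)" for c
    using finite_vimageI[OF less.prems(1), of "\<lambda>i. Inl (i, c)"]
      finite_vimageI[OF less.prems(1), of Inr]
    by (auto simp: inj_def rows_of_def columns_of_def vimage_def intro: rev_finite_subset)
  show ?case
  proof (cases "\<exists>i k. Inl (i, blk k) \<in> N \<and> Inr k \<in> N")
    case False
    then have "rows_of N c = {} \<or> columns_of blk N c = {}" for c
      by (auto simp: rows_of_def columns_of_def)
    then have "?w N c = 0" for c by (metis card.empty segre_depth_summand_def)
    moreover have "?J N = max_ideal" using False by (intro segre_ideal_edgeless) blast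
    ultimately show ?thesis using depth_eq_m by simp
  next
    case True
    then obtain i k where a: "Inl (i, blk k) \<in> N" and b: "Inr k \<in> N" by blast
    define a where "a = (Inl (i, blk k) :: (nat \<times> 'c) + nat)"
    define b where "b = (Inr k :: (nat \<times> 'c) + nat)"
    have ab: "a \<in> N" "b \<in> N" "a \<noteq> b" using a b by (auto simp: a_def b_def)
    define c where "c = blk k"
    define r where "r = card (rows_of N c)"
    define s where "s = card (columns_of blk N c)"
    \<comment> \<open>the blocks other than \<open>c\<close> contribute the same to all four ideals\<close>
    define R where "R = (\<Sum>c'\<in>C - {c}. ?w N c')"
    have cC: "c \<in> C" using less.prems(3)[OF b] by (simp add: c_def)
    have split: "(\<Sum>c'\<in>C. ?w M c') = R + ?w M c" if M: "M \<in> {N, N - {a}, N - {b}, N - {a, b}}" for M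
    proof -
      have "?w M c' = ?w N c'" if "c' \<noteq> c" for c'
      proof -
        have "rows_of M c' = rows_of N c'" "columns_of blk M c' = columns_of blk N c'"
          using M that by (auto simp: rows_of_def columns_of_def a_def b_def c_def)
        then show ?thesis by simp
      qed
      then have "(\<Sum>c'\<in>C - {c}. ?w M c') = R" unfolding R_def by (intro sum.cong) auto
      then show ?thesis using sum.remove[OF assms(3) cC, of "?w M"] by simp
    qed
    have i: "i \<in> rows_of N c" using a by (simp add: rows_of_def c_def)
    have k: "k \<in> columns_of blk N c" using b by (simp add: columns_of_def c_def)
    have pos: "r > 0" "s > 0" using i k fin by (auto simp: r_def s_def card_gt_0_iff)
    have minus_a: "card (rows_of (N - {a}) c) = r - 1" "columns_of blk (N - {a}) c = columns_of blk N c"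
    proof -
      have "rows_of (N - {a}) c = rows_of N c - {i}" by (auto simp: rows_of_def a_def c_def)
      then show "card (rows_of (N - {a}) c) = r - 1" using i by (simp add: r_def)
      show "columns_of blk (N - {a}) c = columns_of blk N c" by (auto simp: columns_of_def a_def)
    qed
    have minus_b: "card (columns_of blk (N - {b}) c) = s - 1" "rows_of (N - {b}) c = rows_of N c"
    proof -
      have "columns_of blk (N - {b}) c = columns_of blk N c - {k}" by (auto simp: columns_of_def b_def c_def)
      then show "card (columns_of blk (N - {b}) c) = s - 1" using k by (simp add: s_def)
      show "rows_of (N - {b}) c = rows_of N c" by (auto simp: rows_of_def b_def)
    qed
    have minus_ab: "card (rows_of (N - {a, b}) c) = r - 1" "card (columns_of blk (N - {a, b}) c) = s - 1"
    proof -
      have "rows_of (N - {a, b}) c = rows_of (N - {a}) c" by (auto simp: rows_of_def b_def)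
      then show "card (rows_of (N - {a, b}) c) = r - 1" using minus_a(1) by simp
      have "columns_of blk (N - {a, b}) c = columns_of blk (N - {b}) c" by (auto simp: columns_of_def a_def)
      then show "card (columns_of blk (N - {a, b}) c) = s - 1" using minus_b(1) by simp
    qed
    have IH: "depth_eq (?J M) (\<Sum>c\<in>C. ?w M c)" if "M \<subset> N" for M
      using that less.prems
      by (intro less.hyps psubset_card_mono) (auto intro: finite_subset)
    have da: "depth_eq (?J (N - {a})) (R + segre_depth_summand (r - 1) s)"
      using IH[of "N - {a}"] ab split[of "N - {a}"] minus_a by (auto simp: s_def)
    have db: "depth_eq (?J (N - {b})) (R + segre_depth_summand r (s - 1))"
      using IH[of "N - {b}"] ab split[of "N - {b}"] minus_b by (auto simp: r_def)
    have dab: "depth_eq (?J (N - {a, b})) (R + segre_depth_summand (r - 1) (s - 1))"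
      using IH[of "N - {a, b}"] ab split[of "N - {a, b}"] minus_ab by auto
    have x: "(var (i, k) :: (nat \<times> nat, 'k) mpoly) \<in> max_ideal"
      by (rule var_in_max_ideal)
    \<comment> \<open>one less than the depth that is to be shown for \<open>N\<close>\<close>
    define d where "d = R + r + s - 2"
    have "depth_eq (?J (N - {a}) \<inter> ?J (N - {b})) d"
    proof -
      consider "r = 1" | "s = 1" | "r \<ge> 2" "s \<ge> 2" using pos by linarith
      then show ?thesis
      proof cases
        case 1
        then have "rows_of N c = {i}" using i unfolding r_def by (metis card_1_singletonE singletonD)
        then have "?J (N - {b}) \<subseteq> ?J (N - {a})"
          unfolding a_def b_def by (intro segre_ideal_drop_last_row) (auto simp: rows_of_def c_def)
        then have "?J (N - {a}) \<inter> ?J (N - {b}) = ?J (N - {b})" by blast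
        moreover have "R + segre_depth_summand r (s - 1) = d"
          using 1 pos by (auto simp: d_def segre_depth_summand_def)
        ultimately show ?thesis using db by simp
      next
        case 2
        then have "columns_of blk N c = {k}" using k unfolding s_def by (metis card_1_singletonE singletonD)
        then have "?J (N - {a}) \<subseteq> ?J (N - {b})"
          unfolding a_def b_def by (intro segre_ideal_drop_last_column) (auto simp: columns_of_def c_def)
        then have "?J (N - {a}) \<inter> ?J (N - {b}) = ?J (N - {a})" by blast
        moreover have "R + segre_depth_summand (r - 1) s = d"
          using 2 pos by (auto simp: d_def segre_depth_summand_def)
        ultimately show ?thesis using da by simp
      next
        case 3
        define e where "e = R + (r - 1) + (s - 1) - 1"
        have e: "R + segre_depth_summand (r - 1) s = Suc e" "R + segre_depth_summand r (s - 1) = Suc e"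
          "R + segre_depth_summand (r - 1) (s - 1) = e" "d = Suc e"
          using 3 by (auto simp: d_def e_def segre_depth_summand_def)
        show ?thesis
          unfolding e(4) using da db dab e adm[of "N - {a}"] adm[of "N - {b}"]
          by (intro depth_eq_Int) (auto simp: sum_segre_ideals depth_eq_def)
      qed
    qed
    then have "depth_eq (adjoin (?J N) (var (i, k))) d"
      by (simp add: adjoin_var_segre a_def b_def)
    then have "depth_eq (?J N) (Suc d)"
      using depth_eq_adjoin_iff[OF adm[OF order_refl] x nonzerodivisor_var_segre[of i blk k N]] a b by simp
    moreover have "(\<Sum>c'\<in>C. ?w N c') = Suc d"
      using split[of N] pos by (simp add: d_def segre_depth_summand_def r_def s_def)
    ultimately show ?thesis by simp
  qed
qed

section \<open>Edge ideals and their decomposition at a vertex\<close>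

definition minor :: "nat \<Rightarrow> nat \<Rightarrow> nat \<Rightarrow> nat \<Rightarrow> (nat \<times> nat, 'k::comm_ring_1) mpoly" where
  "minor i j k l = var (i, k) * var (j, l) - var (i, l) * var (j, k)"

text \<open>
  Taking all row indices and both orders of an edge adds only zero and the negatives of minors, and it
  makes the generators symmetric. The variables that do not belong to the graph are included.
\<close>

definition edge_ideal_gens :: "nat \<Rightarrow> nat sgraph \<Rightarrow> (nat \<times> nat, 'k::comm_ring_1) mpoly set" where
  "edge_ideal_gens m G =
     {minor i j k l | i j k l. i \<in> {1..m} \<and> j \<in> {1..m} \<and> {k, l} \<in> edges G} \<union>
     {var (i, k) | i k. \<not> (i \<in> {1..m} \<and> k \<in> verts G)}"

definition edge_ideal :: "nat \<Rightarrow> nat sgraph \<Rightarrow> (nat \<times> nat, 'k::comm_ring_1) mpoly set" where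
  "edge_ideal m G = ideals.span (edge_ideal_gens m G)"

lemma ideal_edge_ideal: "ideals.subspace (edge_ideal m G)"
  by (simp add: edge_ideal_def)

lemma minor_in_edge_ideal:
  "i \<in> {1..m} \<Longrightarrow> j \<in> {1..m} \<Longrightarrow> {k, l} \<in> edges G \<Longrightarrow> minor i j k l \<in> edge_ideal m G"
  unfolding edge_ideal_def edge_ideal_gens_def by (intro ideals.span_base) blast

lemma var_in_edge_ideal: "\<not> (i \<in> {1..m} \<and> k \<in> verts G) \<Longrightarrow> var (i, k) \<in> edge_ideal m G"
  unfolding edge_ideal_def edge_ideal_gens_def by (intro ideals.span_base) blast

lemma edge_ideal_minimal:
  assumes "ideals.subspace J"
    and "\<And>i j k l. i \<in> {1..m} \<Longrightarrow> j \<in> {1..m} \<Longrightarrow> {k, l} \<in> edges G \<Longrightarrow> minor i j k l \<in> J"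
    and "\<And>i k. \<not> (i \<in> {1..m} \<and> k \<in> verts G) \<Longrightarrow> var (i, k) \<in> J"
  shows "edge_ideal m G \<subseteq> J"
  unfolding edge_ideal_def edge_ideal_gens_def using assms by (intro ideals.span_minimal) blast+

lemma vars_outside_le_edge_ideal:
  assumes "{1..m} \<times> verts G \<subseteq> I"
  shows "(vars_outside_ideal I :: (nat \<times> nat, 'a::comm_ring_1) mpoly set) \<subseteq> edge_ideal m G"
  unfolding vars_outside_ideal_eq_span
proof (intro ideals.span_minimal ideal_edge_ideal subsetI)
  fix x :: "(nat \<times> nat, 'a) mpoly" assume "x \<in> var ` (- I)"
  then obtain i k where "x = var (i, k)" "(i, k) \<notin> I" by auto
  then show "x \<in> edge_ideal m G" using assms var_in_edge_ideal[of i m k G] by blast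
qed

lemma edge_ideal_le_max: "edge_ideal m G \<subseteq> max_ideal"
  unfolding minor_def
  by (intro edge_ideal_minimal ideal_max)
     (auto simp: minor_def intro: ideals.subspace_diff[OF ideal_max] ideals.subspace_scale[OF ideal_max] var_in_max_ideal)

abbreviation vertex_vars :: "nat \<Rightarrow> (nat \<times> nat) set" where
  "vertex_vars v \<equiv> {p. snd p = v}"

lemma edge_ideal_del_vert:
  "edge_ideal m (del_verts G {v}) = ideals.span (edge_ideal m G \<union> vars_outside_ideal (- vertex_vars v))"
  (is "?L = ?R")
proof
  have v: "var (i, v) \<in> ?R" for i
    unfolding vars_outside_ideal_eq_span by (intro ideals.span_base UnI2) auto
  have G: "f \<in> ?R" if "f \<in> edge_ideal m G" for f using that by (intro ideals.span_base) blast
  show "?L \<subseteq> ?R"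
  proof (rule edge_ideal_minimal)
    show "minor i j k l \<in> ?R"
      if "i \<in> {1..m}" "j \<in> {1..m}" "{k, l} \<in> edges (del_verts G {v})" for i j k l
      using that by (intro G minor_in_edge_ideal) (auto simp: del_verts_def)
    show "var (i, k) \<in> ?R" if "\<not> (i \<in> {1..m} \<and> k \<in> verts (del_verts G {v}))" for i k
      using that v G[OF var_in_edge_ideal] by (cases "k = v") (auto simp: del_verts_def)
  qed simp
  have v': "var (i, v) \<in> ?L" for i by (rule var_in_edge_ideal) (simp add: del_verts_def)
  have "edge_ideal m G \<subseteq> ?L"
  proof (rule edge_ideal_minimal[OF ideal_edge_ideal])
    fix i j k l assume *: "i \<in> {1..m}" "j \<in> {1..m}" "{k, l} \<in> edges G"
    show "minor i j k l \<in> ?L"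
    proof (cases "v \<in> {k, l}")
      case True
      then consider "k = v" | "l = v" by blast
      then have "var (i, k) * var (j, l) \<in> ?L \<and> var (i, l) * var (j, k) \<in> ?L"
        by cases (simp_all add: v' ideal_mult_left[OF ideal_edge_ideal] ideal_mult_right[OF ideal_edge_ideal])
      then show ?thesis unfolding minor_def by (blast intro: ideals.subspace_diff[OF ideal_edge_ideal])
    next
      case False
      then show ?thesis using * by (intro minor_in_edge_ideal) (auto simp: del_verts_def)
    qed
  qed (auto intro: var_in_edge_ideal simp: del_verts_def)
  moreover have "vars_outside_ideal (- vertex_vars v) \<subseteq> ?L"
    unfolding vars_outside_ideal_eq_span
    using v' by (intro ideals.span_minimal ideal_edge_ideal) auto
  ultimately show "?R \<subseteq> ?L" by (intro ideals.span_minimal ideal_edge_ideal) blast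
qed

lemma edge_ideal_le_complete_nbrs: "edge_ideal m G \<subseteq> edge_ideal m (complete_nbrs G v)"
  by (intro edge_ideal_minimal ideal_edge_ideal minor_in_edge_ideal var_in_edge_ideal)
     (auto simp: complete_nbrs_def)

lemma edge_ideal_sum:
  "ideals.span (edge_ideal m (complete_nbrs G v) \<union> edge_ideal m (del_verts G {v})) =
     edge_ideal m (del_verts (complete_nbrs G v) {v})"
  (is "?L = ?R")
proof
  show "?L \<subseteq> ?R"
    unfolding edge_ideal_del_vert using edge_ideal_le_complete_nbrs[of m G v]
    by (intro ideals.span_minimal Un_least ideals.subspace_span) (auto intro: ideals.span_base)
  show "?R \<subseteq> ?L"
    unfolding edge_ideal_del_vert
    by (intro ideals.span_mono) (auto intro: ideals.span_base)
qed

text \<open>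
  The reason for the decomposition at a vertex: if \<open>u\<close> and \<open>w\<close> are neighbours of \<open>v\<close>, the columns
  \<open>u\<close> and \<open>w\<close> are proportional to the column \<open>v\<close> modulo the edge ideal, hence to each other wherever
  column \<open>v\<close> does not vanish.
\<close>

lemma var_times_minor:
  "var (h, v) * minor i j u w =
     var (j, w) * minor h i v u + var (h, u) * minor i j v w - var (i, w) * minor h j v u"
  by (simp add: minor_def algebra_simps)

lemma var_times_minor_in_edge_ideal:
  assumes "i \<in> {1..m}" "j \<in> {1..m}" "{u, v} \<in> edges G" "{w, v} \<in> edges G"
  shows "var (h, v) * minor i j u w \<in> edge_ideal m G"
proof (cases "h \<in> {1..m}")
  case True
  have "{v, u} \<in> edges G" "{v, w} \<in> edges G" using assms(3,4) by (simp_all add: insert_commute)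
  then show ?thesis
    using True assms(1,2)
    by (subst var_times_minor) (intro ideals.subspace_diff[OF ideal_edge_ideal] ideals.subspace_add[OF ideal_edge_ideal]
        ideals.subspace_scale[OF ideal_edge_ideal] minor_in_edge_ideal)
next
  case False
  then show ?thesis by (intro ideal_mult_right[OF ideal_edge_ideal] var_in_edge_ideal) blast
qed

lemma restrict_vars_minor:
  assumes "k \<noteq> l"
  shows "restrict_vars (- vertex_vars v) (minor i j k l) = (if v \<in> {k, l} then 0 else minor i j k l)"
  by (auto simp: minor_def restrict_vars_diff restrict_vars_mult restrict_vars_var)

text \<open>
  The part of \<open>f\<close> that involves a variable of \<open>v\<close> needs only generators of \<open>edge_ideal m G\<close>, since the
  additional minors come with a coefficient in the ideal of these variables.
\<close>

lemma complete_nbrs_vertex_part: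
  assumes G: "finite_simple_graph G" and f: "f \<in> edge_ideal m (complete_nbrs G v)"
  shows "f - restrict_vars (- vertex_vars v) f \<in> edge_ideal m G"
proof -
  let ?r = "restrict_vars (- vertex_vars v)"
  let ?J = "edge_ideal m G"
  have ne: "k \<noteq> l" if "{k, l} \<in> edges G" for k l
    using G that unfolding finite_simple_graph_def by (auto simp: doubleton_eq_iff)
  show ?thesis
    using f unfolding edge_ideal_def[of m "complete_nbrs G v"]
  proof (induction f rule: ideals.span_induct_alt)
    case base
    show ?case using ideals.subspace_0[OF ideal_edge_ideal] by (simp add: restrict_vars_def)
  next
    case (step c x y)
    have "(c - ?r c) * x \<in> ?J \<and> x - ?r x \<in> ?J"
    proof -
      consider (old) i j k l where "x = minor i j k l" "i \<in> {1..m}" "j \<in> {1..m}" "{k, l} \<in> edges G"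
        | (new) i j u w where "x = minor i j u w" "i \<in> {1..m}" "j \<in> {1..m}" "{u, v} \<in> edges G" "{w, v} \<in> edges G" "u \<noteq> w"
        | (outside) i k where "x = var (i, k)" "\<not> (i \<in> {1..m} \<and> k \<in> verts G)"
        using step.hyps unfolding edge_ideal_gens_def complete_nbrs_def nbrs_def
        by (auto simp: doubleton_eq_iff)
      then show ?thesis
      proof cases
        case old
        have "x \<in> ?J" using old by (auto intro: minor_in_edge_ideal)
        moreover have "?r x \<in> {0, x}" unfolding old(1) restrict_vars_minor[OF ne[OF old(4)]] by simp
        ultimately show ?thesis
          using ideals.subspace_0[OF ideal_edge_ideal, of m G] ideal_mult_left[OF ideal_edge_ideal] by auto
      next
        case outside
        have "x \<in> ?J" unfolding outside(1) using outside(2) by (rule var_in_edge_ideal)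
        moreover have "?r x \<in> {0, x}" unfolding outside(1) restrict_vars_var by simp
        ultimately show ?thesis
          using ideals.subspace_0[OF ideal_edge_ideal, of m G] ideal_mult_left[OF ideal_edge_ideal] by auto
      next
        case new
        have "?r x = x"
          unfolding new(1) restrict_vars_minor[OF new(6)] using ne[OF new(4)] ne[OF new(5)] by auto
        moreover have "vars_outside_ideal (- vertex_vars v) \<subseteq> colon ?J x"
          unfolding vars_outside_ideal_eq_span
          using var_times_minor_in_edge_ideal[OF new(2-5)]
          by (intro ideals.span_minimal ideal_colon ideal_edge_ideal) (auto simp: colon_def new(1))
        then have "(c - ?r c) * x \<in> ?J" using diff_restrict_vars by (auto simp: colon_def)
        ultimately show ?thesis using ideals.subspace_0[OF ideal_edge_ideal, of m G] by simp
      qed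
    qed
    moreover have "(c * x + y) - ?r (c * x + y) = ((c - ?r c) * x + ?r c * (x - ?r x)) + (y - ?r y)"
      by (simp add: restrict_vars_add restrict_vars_mult algebra_simps)
    ultimately show ?case
      using step.IH
      by (auto simp only: intro!: ideals.subspace_add[OF ideal_edge_ideal] ideals.subspace_scale[OF ideal_edge_ideal])
  qed
qed

text \<open>
  By the modular law only elements of the ideal of \<open>G\<^sub>v\<close> that are in the ideal of the variables of \<open>v\<close>
  have to be considered, and these coincide with their part that involves \<open>v\<close>.
\<close>

theorem edge_ideal_Int:
  assumes "finite_simple_graph G"
  shows "edge_ideal m G = edge_ideal m (complete_nbrs G v) \<inter> edge_ideal m (del_verts G {v})"
proof
  show "edge_ideal m G \<subseteq> edge_ideal m (complete_nbrs G v) \<inter> edge_ideal m (del_verts G {v})"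
    using edge_ideal_le_complete_nbrs[of m G v] unfolding edge_ideal_del_vert
    by (auto intro: ideals.span_base)
  show "edge_ideal m (complete_nbrs G v) \<inter> edge_ideal m (del_verts G {v}) \<subseteq> edge_ideal m G"
  proof
    fix f assume f: "f \<in> edge_ideal m (complete_nbrs G v) \<inter> edge_ideal m (del_verts G {v})"
    then have "f \<in> edge_ideal m (del_verts G {v})" by blast
    then obtain g h where gh: "g \<in> edge_ideal m G" "h \<in> vars_outside_ideal (- vertex_vars v)" "f = g + h"
      unfolding edge_ideal_del_vert mem_ideal_sum[OF ideal_edge_ideal ideal_vars_outside] by blast
    have "h = f - g" using gh(3) by simp
    then have "h \<in> edge_ideal m (complete_nbrs G v)"
      using f gh(1) edge_ideal_le_complete_nbrs ideals.subspace_diff[OF ideal_edge_ideal] by blast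
    then have "h - restrict_vars (- vertex_vars v) h \<in> edge_ideal m G"
      by (rule complete_nbrs_vertex_part[OF assms])
    then have "h \<in> edge_ideal m G" using gh(2) by (simp add: restrict_vars_eq_0_iff[THEN iffD2])
    then show "f \<in> edge_ideal m G" using gh by (simp add: ideals.subspace_add[OF ideal_edge_ideal])
  qed
qed

section \<open>Components of graphs\<close>

lemma edge_in_verts:
  assumes "finite_simple_graph G" "{a, b} \<in> edges G"
  shows "a \<in> verts G" "b \<in> verts G" "a \<noteq> b"
  using assms unfolding finite_simple_graph_def by (auto simp: doubleton_eq_iff dest!: subsetD)

abbreviation edge_rel :: "'v sgraph \<Rightarrow> ('v \<times> 'v) set" where
  "edge_rel G \<equiv> {(a, b). {a, b} \<in> edges G}"

lemma equiv_reachable: "equiv (verts G) (reachable G)"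
proof (rule equivI)
  show "reachable G \<subseteq> verts G \<times> verts G" by (auto simp: reachable_def)
  show "refl_on (verts G) (reachable G)" by (auto simp: refl_on_def reachable_def)
  have "sym (edge_rel G)" by (auto simp: sym_def insert_commute)
  then have "sym ((edge_rel G)\<^sup>*)" by (rule sym_rtrancl)
  then show "sym (reachable G)" unfolding sym_def reachable_def by blast
  show "trans (reachable G)" unfolding trans_def reachable_def by (auto intro: rtrancl_trans)
qed

definition component_of :: "'v sgraph \<Rightarrow> 'v \<Rightarrow> 'v set" where
  "component_of G v = reachable G `` {v}"

lemma components_eq_image: "components G = component_of G ` verts G"
  by (auto simp: components_def quotient_def component_of_def)

lemma component_of_eq_iff:
  "u \<in> verts G \<Longrightarrow> w \<in> verts G \<Longrightarrow> component_of G u = component_of G w \<longleftrightarrow> (u, w) \<in> reachable G"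
  unfolding component_of_def using eq_equiv_class_iff[OF equiv_reachable] by metis

lemma component_of_self: "v \<in> verts G \<Longrightarrow> v \<in> component_of G v"
  by (auto simp: component_of_def reachable_def)

lemma component_of_edge:
  assumes "finite_simple_graph G" "{a, b} \<in> edges G"
  shows "component_of G a = component_of G b"
  using component_of_eq_iff[OF edge_in_verts(1,2)[OF assms]] edge_in_verts[OF assms] assms(2)
  by (auto simp: reachable_def)

lemma num_components_connected:
  assumes "connected_graph G"
  shows "num_components G = 1"
proof -
  obtain v where v: "v \<in> verts G" using assms by (auto simp: connected_graph_def)
  have "component_of G u = component_of G v" if "u \<in> verts G" for u
    using assms that v component_of_eq_iff[of u G v] by (auto simp: connected_graph_def)
  then have "components G = (\<lambda>_. component_of G v) ` verts G"
    unfolding components_eq_image by (rule image_cong[OF refl])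
  then have "components G = {component_of G v}" using v by auto
  then show ?thesis by (simp add: num_components_def)
qed

lemma mem_component_iff:
  assumes "c \<in> components G"
  shows "k \<in> c \<longleftrightarrow> k \<in> verts G \<and> component_of G k = c"
proof -
  obtain u where u: "u \<in> verts G" "c = component_of G u" using assms by (auto simp: components_eq_image)
  have "k \<in> c \<longleftrightarrow> (u, k) \<in> reachable G" by (simp add: u component_of_def)
  also have "\<dots> \<longleftrightarrow> k \<in> verts G \<and> component_of G k = c"
    using component_of_eq_iff[OF u(1), of k] by (auto simp: u(2) reachable_def)
  finally show ?thesis .
qed

lemma card_verts_eq_sum_components:
  assumes "finite (verts G)"
  shows "card (verts G) = (\<Sum>c\<in>components G. card c)"
proof -
  have "verts G = (\<Union>c\<in>components G. c)"
    using component_of_self by (auto simp: components_eq_image component_of_def reachable_def)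
  moreover have "finite c" if "c \<in> components G" for c
    using that by (intro finite_subset[OF _ assms]) (auto simp: components_eq_image component_of_def reachable_def)
  moreover have "c \<inter> c' = {}" if "c \<in> components G" "c' \<in> components G" "c \<noteq> c'" for c c'
    using that(3) mem_component_iff[OF that(1)] mem_component_iff[OF that(2)] by auto
  moreover have "finite (components G)" using assms by (simp add: components_eq_image)
  ultimately show ?thesis using card_UN_disjoint[of "components G" "\<lambda>c. c"] by simp
qed

lemma finite_simple_del_verts:
  assumes "finite_simple_graph G"
  shows "finite_simple_graph (del_verts G T)"
  unfolding finite_simple_graph_def
proof (intro conjI subsetI)
  show "finite (verts (del_verts G T))"
    using assms by (simp add: finite_simple_graph_def del_verts_def)
  fix e assume "e \<in> edges (del_verts G T)"
  then have e: "e \<in> edges G" "e \<inter> T = {}" by (auto simp: del_verts_def)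
  then obtain u w where "e = {u, w}" "u \<in> verts G" "w \<in> verts G" "u \<noteq> w"
    using assms unfolding finite_simple_graph_def by blast
  then show "e \<in> {{u, w} | u w. u \<in> verts (del_verts G T) \<and> w \<in> verts (del_verts G T) \<and> u \<noteq> w}"
    using e(2) by (auto simp: del_verts_def)
qed

lemma finite_simple_complete_nbrs: "finite_simple_graph G \<Longrightarrow> finite_simple_graph (complete_nbrs G v)"
  unfolding finite_simple_graph_def complete_nbrs_def nbrs_def by auto

lemma del_verts_empty: "del_verts G {} = G"
  by (simp add: del_verts_def)

lemma num_components_del_cut_vertex:
  assumes "unmixed G" "cut_vertex G v"
  shows "num_components (del_verts G {v}) = Suc (num_components G)"
proof -
  have "cut_set G {v}"
    using assms(2) by (auto simp: cut_set_def del_verts_empty cut_vertex_def)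
  then show ?thesis using assms(1) by (auto simp: unmixed_def)
qed

lemma edge_rel_complete_nbrs_rtrancl:
  "(edge_rel (complete_nbrs G v))\<^sup>* = (edge_rel G)\<^sup>*"
proof (rule rtrancl_subset)
  show "edge_rel G \<subseteq> edge_rel (complete_nbrs G v)" by (auto simp: complete_nbrs_def)
  have "(a, b) \<in> (edge_rel G)\<^sup>*" if "a \<in> nbrs G v" "b \<in> nbrs G v" for a b
  proof -
    have "(a, v) \<in> edge_rel G" "(v, b) \<in> edge_rel G"
      using that by (auto simp: nbrs_def insert_commute)
    then show ?thesis by (meson converse_rtrancl_into_rtrancl r_into_rtrancl)
  qed
  then show "edge_rel (complete_nbrs G v) \<subseteq> (edge_rel G)\<^sup>*"
    by (auto simp: complete_nbrs_def doubleton_eq_iff)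
qed

lemma num_components_complete_nbrs: "num_components (complete_nbrs G v) = num_components G"
proof -
  have "reachable (complete_nbrs G v) = reachable G"
    unfolding reachable_def edge_rel_complete_nbrs_rtrancl by (simp add: complete_nbrs_def)
  moreover have "verts (complete_nbrs G v) = verts G" by (simp add: complete_nbrs_def)
  ultimately show ?thesis by (simp add: num_components_def components_def)
qed

text \<open>
  A walk that passes through \<open>v\<close> does so between two neighbours of \<open>v\<close>, which are equal or adjacent in
  \<open>G\<^sub>v\<close>. The case \<open>w = v\<close> of the induction remembers a neighbour of \<open>v\<close> that is reached without
  passing through \<open>v\<close>.
\<close>

lemma bypass_vertex:
  assumes G: "finite_simple_graph G" and "(u, w) \<in> (edge_rel G)\<^sup>*" "u \<noteq> v"
  defines "H \<equiv> del_verts (complete_nbrs G v) {v}"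
  shows "if w = v then \<exists>z\<in>nbrs G v. (u, z) \<in> (edge_rel H)\<^sup>* else (u, w) \<in> (edge_rel H)\<^sup>*"
  using assms(2)
proof (induction rule: rtrancl_induct)
  case base
  then show ?case using assms(3) by simp
next
  case (step y y')
  have e: "{y, y'} \<in> edges G" using step.hyps(2) by simp
  note y = edge_in_verts[OF G e]
  consider "y = v" | "y \<noteq> v" "y' = v" | "y \<noteq> v" "y' \<noteq> v" by blast
  then show ?case
  proof cases
    case 1
    then obtain z where z: "z \<in> nbrs G v" "(u, z) \<in> (edge_rel H)\<^sup>*" using step.IH by auto
    have y': "y' \<in> nbrs G v" using e y 1 by (simp add: nbrs_def insert_commute)
    have "v \<notin> nbrs G v" using edge_in_verts(3)[OF G, of v v] by (auto simp: nbrs_def)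
    then have "z = y' \<or> (z, y') \<in> edge_rel H"
      using z(1) y' by (auto simp: H_def del_verts_def complete_nbrs_def)
    then show ?thesis using z(2) y(3) 1 by (auto intro: rtrancl_into_rtrancl)
  next
    case 2
    then show ?thesis using e y step.IH by (auto simp: nbrs_def)
  next
    case 3
    then have "(y, y') \<in> edge_rel H"
      using e by (auto simp: H_def del_verts_def complete_nbrs_def)
    then show ?thesis using 3 step.IH by (auto intro: rtrancl_into_rtrancl)
  qed
qed

lemma component_of_bypassed:
  assumes G: "finite_simple_graph G" and u: "u \<in> verts G - {v}"
  shows "component_of (del_verts (complete_nbrs G v) {v}) u = component_of G u - {v}"
proof -
  let ?H = "del_verts (complete_nbrs G v) {v}"
  have "(edge_rel ?H)\<^sup>* \<subseteq> (edge_rel (complete_nbrs G v))\<^sup>*"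
    by (intro rtrancl_mono) (auto simp: del_verts_def)
  then have "(edge_rel ?H)\<^sup>* \<subseteq> (edge_rel G)\<^sup>*" by (simp only: edge_rel_complete_nbrs_rtrancl)
  moreover have "(u, w) \<in> (edge_rel ?H)\<^sup>*" if "(u, w) \<in> (edge_rel G)\<^sup>*" "w \<noteq> v" for w
    using bypass_vertex[OF G that(1)] u that(2) by auto
  ultimately have "(u, w) \<in> reachable ?H \<longleftrightarrow> (u, w) \<in> reachable G \<and> w \<noteq> v" for w
    using u unfolding reachable_def
    by (auto simp: del_verts_def[of "complete_nbrs G v"] complete_nbrs_def[of G v, THEN arg_cong[where f=verts]])
  then show ?thesis by (auto simp: component_of_def)
qed

text \<open>
  Removing \<open>v\<close> from the components of \<open>G\<close> gives those of \<open>G\<^sub>v - v\<close>, except that no component may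
  be lost. This would happen if \<open>v\<close> were isolated; but then \<open>G - v\<close> would have fewer components
  than \<open>G\<close>, and \<open>v\<close> would not be a cut vertex.
\<close>

lemma num_components_bypassed:
  assumes G: "finite_simple_graph G" and v: "cut_vertex G v"
  shows "num_components (del_verts (complete_nbrs G v) {v}) = num_components G"
proof -
  let ?H = "del_verts (complete_nbrs G v) {v}"
  have vH: "verts ?H = verts G - {v}" by (simp add: del_verts_def complete_nbrs_def)
  have fin: "finite (verts G)" using G by (simp add: finite_simple_graph_def)
  have cH: "components ?H = (\<lambda>u. component_of G u - {v}) ` (verts G - {v})"
    unfolding components_eq_image vH using component_of_bypassed[OF G] by (intro image_cong) auto
  have finG: "finite (components G)" "finite (components ?H)"
    using fin by (auto simp: components_eq_image[of G] cH)
  have "components ?H \<subseteq> (\<lambda>c. c - {v}) ` components G"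
    unfolding cH components_eq_image[of G] by auto
  then have le: "num_components ?H \<le> num_components G"
    unfolding num_components_def using finG(1) by (meson card_image_le card_mono finite_imageI le_trans)
  have "nbrs G v \<noteq> {}"
  proof
    assume "nbrs G v = {}"
    then have "complete_nbrs G v = G" by (simp add: complete_nbrs_def)
    then show False using le v by (simp add: cut_vertex_def)
  qed
  then obtain z where z: "z \<in> verts G" "{z, v} \<in> edges G" by (auto simp: nbrs_def)
  have zv: "z \<noteq> v" "component_of G z = component_of G v"
    using edge_in_verts(3)[OF G z(2)] component_of_edge[OF G z(2)] by auto
  have "components G \<subseteq> (\<lambda>c. reachable G `` c) ` components ?H"
  proof
    fix c assume c: "c \<in> components G"
    then obtain u where u: "u \<in> verts G - {v}" "c = component_of G u"
      using z(1) zv by (auto simp: components_eq_image)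
    have "reachable G `` (component_of G u - {v}) = component_of G u"
    proof
      show "reachable G `` (component_of G u - {v}) \<subseteq> component_of G u"
        using equiv_reachable[of G] unfolding component_of_def equiv_def trans_def by blast
      show "component_of G u \<subseteq> reachable G `` (component_of G u - {v})"
        using u(1) component_of_self[of u G] unfolding component_of_def by blast
    qed
    then show "c \<in> (\<lambda>c. reachable G `` c) ` components ?H"
      using u unfolding cH by (auto intro!: image_eqI)
  qed
  then have "num_components G \<le> num_components ?H"
    unfolding num_components_def using finG(2) by (meson card_image_le card_mono finite_imageI le_trans)
  then show ?thesis using le by simp
qed

section \<open>Graphs with complete components\<close>

text \<open>
  One block for each component of the graph, with all rows and with its vertices as columns.
\<close>

definition full_nodes :: "nat \<Rightarrow> nat sgraph \<Rightarrow> ((nat \<times> nat set) + nat) set" where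
  "full_nodes m G = Inl ` ({1..m} \<times> components G) \<union> Inr ` verts G"

lemma single_outside_in_edge_ideal:
  assumes "\<not> Poly_Mapping.keys (segre_degree (component_of G) t) \<subseteq> full_nodes m G"
  shows "Poly_Mapping.single t c \<in> edge_ideal m G"
proof -
  have "\<exists>(i, k)\<in>Poly_Mapping.keys t. \<not> (i \<in> {1..m} \<and> k \<in> verts G)"
  proof (rule ccontr)
    assume "\<not> ?thesis"
    then have "{Inl (i, component_of G k), Inr k} \<subseteq> full_nodes m G" if "(i, k) \<in> Poly_Mapping.keys t" for i k
      using that unfolding full_nodes_def components_eq_image by blast
    then show False using assms unfolding keys_segre_degree by blast
  qed
  then obtain i k where ik: "(i, k) \<in> Poly_Mapping.keys t" "\<not> (i \<in> {1..m} \<and> k \<in> verts G)"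
    by blast
  obtain s where s: "t = Poly_Mapping.single (i, k) 1 + s" using split_off_variable[OF ik(1)] .
  show ?thesis
    unfolding s single_split_variable by (intro ideal_mult_left[OF ideal_edge_ideal] var_in_edge_ideal ik(2))
qed

text \<open>
  The minors of a block connect all monomials of the same degree: a variable of \<open>s\<close> is made to occur
  in \<open>t\<close> with the help of one minor, and then it can be cancelled on both sides.
\<close>

lemma same_degree_congruent:
  assumes G: "finite_simple_graph G" "complete_components G"
    and "segre_degree (component_of G) s = segre_degree (component_of G) t"
    and "Poly_Mapping.keys (segre_degree (component_of G) s) \<subseteq> full_nodes m G"
  shows "(Poly_Mapping.single s c - Poly_Mapping.single t c :: (nat \<times> nat, 'k::comm_ring_1) mpoly)
           \<in> edge_ideal m G"
  using assms(3,4)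
proof (induction s arbitrary: t rule: monomial_induct)
  case zero
  have "t = 0"
  proof (rule ccontr)
    assume "t \<noteq> 0"
    then obtain i k where "(i, k) \<in> Poly_Mapping.keys t" by (metis ex_in_conv keys_eq_empty surj_pair)
    then have "Inr k \<in> Poly_Mapping.keys (segre_degree (component_of G) t)"
      unfolding keys_segre_degree by blast
    then show False using zero by (simp add: segre_degree_def flip: zero(1))
  qed
  then show ?case using ideals.subspace_0[OF ideal_edge_ideal] by simp
next
  case (add v s)
  let ?d = "segre_degree (component_of G)"
  obtain i k where v: "v = (i, k)" by (cases v)
  have N: "Poly_Mapping.keys (?d t) \<subseteq> full_nodes m G" using add.prems by simp
  have ik: "Inl (i, component_of G k) \<in> Poly_Mapping.keys (?d t)" "Inr k \<in> Poly_Mapping.keys (?d t)"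
    unfolding add.prems(1)[symmetric] v by (simp_all add: keys_segre_degree keys_add_nat)
  have "\<exists>t'. ?d t = ?d (Poly_Mapping.single (i, k) 1 + t') \<and>
      Poly_Mapping.single (Poly_Mapping.single (i, k) 1 + t') c - Poly_Mapping.single t c \<in> edge_ideal m G"
  proof (cases "(i, k) \<in> Poly_Mapping.keys t")
    case True
    then obtain t' where "t = Poly_Mapping.single (i, k) 1 + t'" by (rule split_off_variable)
    then show ?thesis using ideals.subspace_0[OF ideal_edge_ideal] by (intro exI[of _ t']) simp
  next
    case False
    then obtain j l r where r: "component_of G l = component_of G k"
      "t = Poly_Mapping.single (i, l) 1 + (Poly_Mapping.single (j, k) 1 + r)"
      using segre_degree_two_variables[OF ik] by metis
    have ijkl: "i \<in> {1..m}" "j \<in> {1..m}" "k \<in> verts G" "l \<in> verts G"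
      using N ik unfolding r(2) keys_segre_degree
      by (auto simp: full_nodes_def keys_add_nat)
    have "l \<noteq> k"
    proof
      assume "l = k"
      then show False using False by (auto simp: r(2) keys_add_nat)
    qed
    have "l \<in> component_of G k" "k \<in> component_of G k" "component_of G k \<in> components G"
      using component_of_self[OF ijkl(3)] component_of_self[OF ijkl(4)] ijkl(3) r(1)
      by (auto simp: components_eq_image)
    then have "{k, l} \<in> edges G"
      using G(2)[unfolded complete_components_def, rule_format, of "component_of G k" k l] \<open>l \<noteq> k\<close> by simp
    then have "(minor i j k l :: (nat \<times> nat, 'k) mpoly) \<in> edge_ideal m G" using ijkl by (intro minor_in_edge_ideal)
    moreover have "Poly_Mapping.single (Poly_Mapping.single (i, k) 1 + (Poly_Mapping.single (j, l) 1 + r)) c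
        - Poly_Mapping.single t c = Poly_Mapping.single r c * minor i j k l"
      unfolding r(2) single_split_variable minor_def by (simp add: algebra_simps)
    ultimately show ?thesis
      using segre_degree_swap[of "component_of G" l k i j r] r
      by (intro exI[of _ "Poly_Mapping.single (j, l) 1 + r"])
         (simp add: ideal_mult_left[OF ideal_edge_ideal])
  qed
  then obtain t' where t': "?d t = ?d (Poly_Mapping.single (i, k) 1 + t')"
    "Poly_Mapping.single (Poly_Mapping.single (i, k) 1 + t') c - Poly_Mapping.single t c \<in> edge_ideal m G"
    by blast
  have "?d s = ?d t'" using add.prems(1) t'(1) by (simp add: v segre_degree_add)
  moreover have "Poly_Mapping.keys (?d s) \<subseteq> full_nodes m G"
    using add.prems(2) by (simp add: segre_degree_add keys_add_nat)
  ultimately have "Poly_Mapping.single s c - Poly_Mapping.single t' c \<in> edge_ideal m G"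
    by (rule add.IH)
  then have "(Poly_Mapping.single s c - Poly_Mapping.single t' c) * var v +
      (Poly_Mapping.single (Poly_Mapping.single (i, k) 1 + t') c - Poly_Mapping.single t c) \<in> edge_ideal m G"
    by (intro ideals.subspace_add[OF ideal_edge_ideal] ideal_mult_right[OF ideal_edge_ideal] t'(2))
  moreover have "Poly_Mapping.single (Poly_Mapping.single v 1 + s) c - Poly_Mapping.single t c =
      (Poly_Mapping.single s c - Poly_Mapping.single t' c) * var v +
      (Poly_Mapping.single (Poly_Mapping.single (i, k) 1 + t') c - Poly_Mapping.single t c)"
    unfolding v single_split_variable left_diff_distrib by simp
  ultimately show ?case by (simp only:)
qed

text \<open>
  Modulo the edge ideal every monomial may be replaced by a fixed representative of its degree. This
  turns \<open>f\<close> into a polynomial whose coefficients are those of the image of \<open>f\<close> under the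
  substitution, all of them at degrees that are set to \<open>0\<close>.
\<close>

theorem edge_ideal_eq_segre:
  assumes G: "finite_simple_graph G" "complete_components G"
  shows "edge_ideal m G =
         (segre_ideal (component_of G) (full_nodes m G) :: (nat \<times> nat, 'k::comm_ring_1) mpoly set)"
    (is "?J = ?S")
proof
  let ?d = "segre_degree (component_of G)"
  let ?N = "full_nodes m G"
  show "?J \<subseteq> ?S"
  proof (rule edge_ideal_minimal[OF ideal_segre])
    fix i j k l assume "{k, l} \<in> edges G"
    then have "component_of G k = component_of G l" by (rule component_of_edge[OF G(1)])
    then have "push_monomials ?d (minor i j k l :: (nat \<times> nat, 'k) mpoly) = 0"
      unfolding minor_def var_def
      by (simp add: push_monomials_diff mult_single segre_degree_add segre_degree_single ac_simps)
    then show "minor i j k l \<in> ?S"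
      by (simp add: segre_ideal_def ideals.subspace_0[OF ideal_vars_outside])
  next
    fix i k assume "\<not> (i \<in> {1..m} \<and> k \<in> verts G)"
    then show "var (i, k) \<in> ?S"
      by (intro segre_idealI)
         (auto simp: var_def keys_segre_degree full_nodes_def components_eq_image split: if_splits)
  qed
  show "?S \<subseteq> ?J"
  proof
    fix f :: "(nat \<times> nat, 'k) mpoly" assume f: "f \<in> ?S"
    define rep where "rep u = (SOME t. ?d t = u)" for u
    have rep: "?d (rep (?d t)) = ?d t" for t unfolding rep_def by (rule someI) simp
    have "push_monomials rep (push_monomials ?d f) \<in> ?J"
      unfolding push_monomials_def[of rep]
    proof (rule ideals.subspace_sum[OF ideal_edge_ideal])
      fix u assume u: "u \<in> Poly_Mapping.keys (push_monomials ?d f)"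
      then obtain t where t: "u = ?d t" using keys_push_monomials[of ?d f] by blast
      have "\<not> Poly_Mapping.keys u \<subseteq> ?N"
        using f u by (auto simp: segre_ideal_def vars_outside_ideal_def monomials_in_def)
      then show "Poly_Mapping.single (rep u) (Poly_Mapping.lookup (push_monomials ?d f) u) \<in> ?J"
        using rep[of t] by (intro single_outside_in_edge_ideal) (simp add: t)
    qed
    moreover have "f - push_monomials rep (push_monomials ?d f) \<in> ?J"
    proof -
      have "Poly_Mapping.single t c - Poly_Mapping.single (rep (?d t)) c \<in> ?J" for t c
      proof (cases "Poly_Mapping.keys (?d t) \<subseteq> ?N")
        case True
        then show ?thesis using rep by (intro same_degree_congruent[OF G]) auto
      next
        case False
        then show ?thesis using rep[of t]
          by (intro ideals.subspace_diff[OF ideal_edge_ideal] single_outside_in_edge_ideal) auto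
      qed
      then have "(\<Sum>t\<in>Poly_Mapping.keys f. Poly_Mapping.single t (Poly_Mapping.lookup f t) -
          Poly_Mapping.single (rep (?d t)) (Poly_Mapping.lookup f t)) \<in> ?J"
        by (intro ideals.subspace_sum[OF ideal_edge_ideal])
      then show ?thesis
        unfolding push_monomials_compose push_monomials_def[of "\<lambda>t. rep (?d t)" f] sum_subtractf
          poly_mapping_sum_single[of f, symmetric] .
    qed
    ultimately have "push_monomials rep (push_monomials ?d f) +
        (f - push_monomials rep (push_monomials ?d f)) \<in> ?J"
      by (rule ideals.subspace_add[OF ideal_edge_ideal])
    then show "f \<in> ?J" by simp
  qed
qed

lemma depth_complete_components:
  assumes G: "finite_simple_graph G" "complete_components G" and m: "m \<ge> 1"
  shows "poly_depth_eq (edge_ideal m G :: (nat \<times> nat, 'k::field) mpoly set)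
           ((m - 1) * num_components G + card (verts G))"
proof -
  let ?N = "full_nodes m G" and ?b = "component_of G"
  have fin: "finite (verts G)" using G(1) by (simp add: finite_simple_graph_def)
  then have finC: "finite (components G)" by (simp add: components_eq_image)
  have "poly_depth_eq (segre_ideal ?b ?N :: (nat \<times> nat, 'k) mpoly set)
      (\<Sum>c\<in>components G. segre_depth_summand (card (rows_of ?N c)) (card (columns_of ?b ?N c)))"
    using fin finC
    by (intro depth_segre_ideal[of "{1..m} \<times> verts G"])
       (auto simp: full_nodes_def components_eq_image)
  also have "(\<Sum>c\<in>components G. segre_depth_summand (card (rows_of ?N c)) (card (columns_of ?b ?N c))) =
      (\<Sum>c\<in>components G. (m - 1) + card c)"
  proof (intro sum.cong refl)
    fix c assume c: "c \<in> components G"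
    have "rows_of ?N c = {1..m}" using c by (auto simp: rows_of_def full_nodes_def)
    moreover have "columns_of ?b ?N c = c"
      using mem_component_iff[OF c] by (auto simp: columns_of_def full_nodes_def)
    moreover have "card c > 0"
    proof -
      obtain u where u: "u \<in> verts G" "c = component_of G u" using c by (auto simp: components_eq_image)
      have "u \<in> c" unfolding u(2) using u(1) by (rule component_of_self)
      then have "c \<noteq> {}" by auto
      moreover have "finite c"
        using c by (intro finite_subset[OF _ fin]) (auto simp: components_eq_image component_of_def reachable_def)
      ultimately show ?thesis by (simp add: card_gt_0_iff)
    qed
    ultimately show "segre_depth_summand (card (rows_of ?N c)) (card (columns_of ?b ?N c)) = (m - 1) + card c"
      using m by (simp add: segre_depth_summand_def)
  qed
  also have "\<dots> = (m - 1) * num_components G + card (verts G)"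
    by (simp add: sum.distrib num_components_def card_verts_eq_sum_components[OF fin])
  finally show ?thesis by (simp only: edge_ideal_eq_segre[OF G])
qed

section \<open>Strongly unmixed graphs\<close>

text \<open>
  The induction described at the beginning. The quotients by the ideals of smaller graphs are taken in
  the same ring, so their depths are compared directly.
\<close>

theorem depth_strongly_unmixed:
  assumes "strongly_unmixed G" "finite_simple_graph G" "m \<ge> 2"
  shows "poly_depth_eq (edge_ideal m G :: (nat \<times> nat, 'k::field) mpoly set)
           ((m - 1) * num_components G + card (verts G))"
  using assms(1,2)
proof (induction rule: strongly_unmixed.induct)
  case (complete G)
  then show ?case using assms(3) by (intro depth_complete_components) auto
next
  case (cut G v)
  let ?J = "\<lambda>G. edge_ideal m G :: (nat \<times> nat, 'k) mpoly set"
  have fin: "finite (verts G)" and v: "v \<in> verts G"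
    using cut.prems cut.hyps by (auto simp: finite_simple_graph_def cut_vertex_def)
  interpret noetherian_over "max_ideal :: (nat \<times> nat, 'k) mpoly set" "vars_outside_ideal ({1..m} \<times> verts G)"
    using fin by (intro noetherian_over_polys) simp
  have adm: "admissible (?J H)" if "verts H \<subseteq> verts G" for H
    using that unfolding admissible_def
    by (intro conjI ideal_edge_ideal vars_outside_le_edge_ideal edge_ideal_le_max) auto
  \<comment> \<open>the depth that belongs to \<open>G\<^sub>v - v\<close>\<close>
  define d where "d = (m - 1) * num_components G + card (verts G) - 1"
  have pos: "card (verts G) > 0" using fin v by (auto simp: card_gt_0_iff)
  have verts: "verts (complete_nbrs G v) = verts G" "verts (del_verts G {v}) = verts G - {v}"
    "verts (del_verts (complete_nbrs G v) {v}) = verts G - {v}"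
    by (auto simp: complete_nbrs_def del_verts_def)
  have "depth_eq (?J (del_verts G {v})) ((m - 1) * Suc (num_components G) + (card (verts G) - 1))"
    using cut.IH(1)[OF finite_simple_del_verts[OF cut.prems]]
      num_components_del_cut_vertex[OF cut.hyps(1,2)] v by (simp only: verts card_Diff_singleton)
  moreover have "(m - 1) * Suc (num_components G) + (card (verts G) - 1) \<ge> Suc d"
    using assms(3) pos by (simp add: d_def)
  ultimately have 1: "depth_ge (Suc d) (?J (del_verts G {v}))"
    unfolding depth_eq_def using depth_ge_antimono by blast
  have "depth_eq (?J (complete_nbrs G v)) (Suc d)"
    using cut.IH(2)[OF finite_simple_complete_nbrs[OF cut.prems]] pos
    by (simp add: verts num_components_complete_nbrs d_def)
  then have 2: "depth_ge (Suc d) (?J (complete_nbrs G v))" by (simp add: depth_eq_def)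
  have "depth_eq (?J (del_verts (complete_nbrs G v) {v})) d"
    using cut.IH(3)[OF finite_simple_del_verts[OF finite_simple_complete_nbrs[OF cut.prems]]] pos v
      num_components_bypassed[OF cut.prems cut.hyps(2)]
    by (simp add: verts d_def)
  then have 3: "depth_eq (ideals.span (?J (complete_nbrs G v) \<union> ?J (del_verts G {v}))) d"
    by (simp only: edge_ideal_sum)
  have "depth_eq (?J (complete_nbrs G v) \<inter> ?J (del_verts G {v})) (Suc d)"
    by (intro depth_eq_Int adm 1 2 3) (auto simp: verts)
  then show ?case
    using pos by (simp add: edge_ideal_Int[OF cut.prems, symmetric] d_def)
qed

section \<open>Depth in the polynomial ring of the graph\<close>

lemma mpoly_ring_simps [simp]:
  "carrier (mpoly_ring I) = polys_in I"
  "monoid.mult (mpoly_ring I) f g = f * g"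
  "one (mpoly_ring I) = 1"
  "zero (mpoly_ring I) = 0"
  "add (mpoly_ring I) f g = f + g"
  by (auto simp: mpoly_ring_def polys_in_def monomials_in_def)

lemma a_inv_mpoly_ring: "f \<in> polys_in I \<Longrightarrow> a_inv (mpoly_ring I) f = - f"
  using polys_in_diff[of 0 I f]
  by (intro abelian_group.minus_equality ring.is_abelian_group cring.axioms(1)[OF cring_mpoly_ring])
     (auto simp: polys_in_def)

lemma ideal_Int_polys_in:
  assumes "ideals.subspace K"
  shows "ideal (K \<inter> polys_in I) (mpoly_ring I)"
proof (rule idealI)
  show "ring (mpoly_ring I)" using cring_mpoly_ring by (rule cring.axioms(1))
  show "subgroup (K \<inter> polys_in I) (add_monoid (mpoly_ring I))"
  proof (rule subgroup.intro)
    fix x assume x: "x \<in> K \<inter> polys_in I"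
    have "inv\<^bsub>add_monoid (mpoly_ring I)\<^esub> x = - x"
      using a_inv_mpoly_ring[of x I] x by (simp add: a_inv_def)
    then show "inv\<^bsub>add_monoid (mpoly_ring I)\<^esub> x \<in> K \<inter> polys_in I"
      using x assms polys_in_diff[of 0 I x] by (auto simp: ideals.subspace_neg polys_in_def)
  qed (use assms in \<open>auto simp: ideals.subspace_0 ideals.subspace_add polys_in_add, auto simp: polys_in_def\<close>)
qed (use assms in \<open>auto simp: ideal_mult_left ideal_mult_right polys_in_mult\<close>)

text \<open>
  Setting the variables outside \<open>I\<close> to zero retracts the big polynomial ring onto the one with
  variables in \<open>I\<close>; the ideals of the latter are the intersections with ideals that contain the
  other variables.
\<close>

lemma genideal_mpoly_ring:
  fixes Q :: "('i, 'k::comm_ring_1) mpoly set"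
  assumes Q: "Q \<subseteq> polys_in I"
  shows "Idl\<^bsub>mpoly_ring I\<^esub> Q = ideals.span (Q \<union> vars_outside_ideal I) \<inter> polys_in I"
    (is "?L = ?K \<inter> _")
proof
  interpret R: cring "mpoly_ring I :: ('i, 'k) mpoly ring" by (rule cring_mpoly_ring)
  have L: "ideal ?L (mpoly_ring I)" using Q by (intro R.genideal_ideal) simp
  interpret L: ideal ?L "mpoly_ring I" by (rule L)
  show "?L \<subseteq> ?K \<inter> polys_in I"
    using Q by (intro R.genideal_minimal ideal_Int_polys_in) (auto intro: ideals.span_base)
  have "?K \<subseteq> {f. restrict_vars I f \<in> ?L}"
  proof (rule ideals.span_minimal)
    have "Q \<subseteq> ?L" using Q by (intro R.genideal_self) simp
    then show "Q \<union> vars_outside_ideal I \<subseteq> {f. restrict_vars I f \<in> ?L}"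
      using Q L.zero_closed by (auto simp: restrict_vars_id subset_iff restrict_vars_eq_0_iff[THEN iffD2])
    show "ideals.subspace {f. restrict_vars I f \<in> ?L}"
    proof (rule ideals.subspaceI)
      show "0 \<in> {f. restrict_vars I f \<in> ?L}" using L.zero_closed by (simp add: restrict_vars_def)
      show "f + g \<in> {f. restrict_vars I f \<in> ?L}"
        if "f \<in> {f. restrict_vars I f \<in> ?L}" "g \<in> {f. restrict_vars I f \<in> ?L}" for f g
        using that L.a_closed by (simp add: restrict_vars_add)
      show "c * f \<in> {f. restrict_vars I f \<in> ?L}" if "f \<in> {f. restrict_vars I f \<in> ?L}" for c f
        using that L.I_l_closed[of "restrict_vars I f" "restrict_vars I c"]
        by (simp add: restrict_vars_mult restrict_vars_in)
    qed
  qed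
  then show "?K \<inter> polys_in I \<subseteq> ?L" using restrict_vars_id by fastforce
qed

lemma var_in_polys_in: "v \<in> I \<Longrightarrow> var v \<in> polys_in I"
  using var_in_mpoly_ring[of v I] by simp

lemma homogeneous_max_ideal_eq:
  "homogeneous_max_ideal m G =
     (max_ideal \<inter> polys_in ({1..m} \<times> verts G) :: (nat \<times> nat, 'k::field) mpoly set)"
proof -
  let ?I = "{1..m} \<times> verts G"
  have vars: "{var (i, k) | i k. i \<in> {1..m} \<and> k \<in> verts G} = (var ` ?I :: (nat \<times> nat, 'k) mpoly set)"
    by blast
  have "ideals.span (var ` ?I \<union> vars_outside_ideal ?I) = (max_ideal :: (nat \<times> nat, 'k) mpoly set)"
  proof
    show "ideals.span (var ` ?I \<union> vars_outside_ideal ?I) \<subseteq> (max_ideal :: (nat \<times> nat, 'k) mpoly set)"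
    proof (intro ideals.span_minimal ideal_max Un_least)
      show "var ` ?I \<subseteq> (max_ideal :: (nat \<times> nat, 'k) mpoly set)" by (auto intro: var_in_max_ideal)
      show "vars_outside_ideal ?I \<subseteq> (max_ideal :: (nat \<times> nat, 'k) mpoly set)"
        by (auto simp: max_ideal_eq vars_outside_ideal_def monomials_in_def)
    qed
    show "(max_ideal :: (nat \<times> nat, 'k) mpoly set) \<subseteq> ideals.span (var ` ?I \<union> vars_outside_ideal ?I)"
      unfolding max_ideal_eq vars_outside_ideal_eq_span
    proof (intro ideals.span_minimal ideals.subspace_span subsetI)
      fix x :: "(nat \<times> nat, 'k) mpoly" assume "x \<in> var ` (- {})"
      then show "x \<in> ideals.span (var ` ?I \<union> ideals.span (var ` (- ?I)))"
        using ideals.span_base[of x "var ` (- ?I)"]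
        by (intro ideals.span_base) blast
    qed
  qed
  then show ?thesis
    unfolding homogeneous_max_ideal_def edge_poly_ring_def vars
    by (subst genideal_mpoly_ring) (auto intro: var_in_polys_in)
qed

lemma gen_binomial_edge_ideal_eq:
  assumes G: "finite_simple_graph G"
  shows "gen_binomial_edge_ideal m G =
     (edge_ideal m G \<inter> polys_in ({1..m} \<times> verts G) :: (nat \<times> nat, 'k::field) mpoly set)"
proof -
  let ?I = "{1..m} \<times> verts G"
  let ?Q = "{var (i, k) * var (j, l) - var (i, l) * var (j, k) | i j k l.
          1 \<le> i \<and> i < j \<and> j \<le> m \<and> {k, l} \<in> edges G \<and> k < l} :: (nat \<times> nat, 'k) mpoly set"
  let ?K = "ideals.span (?Q \<union> vars_outside_ideal ?I)"
  have Q: "?Q \<subseteq> polys_in ?I"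
    using edge_in_verts[OF G]
    by (auto intro!: polys_in_diff polys_in_mult var_in_polys_in)
  have "?K = edge_ideal m G"
  proof
    show "?K \<subseteq> edge_ideal m G"
    proof (intro ideals.span_minimal ideal_edge_ideal Un_least vars_outside_le_edge_ideal order_refl subsetI)
      fix x assume "x \<in> ?Q"
      then obtain i j k l where "x = minor i j k l" "i \<in> {1..m}" "j \<in> {1..m}" "{k, l} \<in> edges G"
        unfolding minor_def by fastforce
      then show "x \<in> edge_ideal m G" by (simp only: minor_in_edge_ideal)
    qed
    show "edge_ideal m G \<subseteq> ?K"
    proof (rule edge_ideal_minimal)
      have ordered: "minor i j k l \<in> ?K"
        if "i \<in> {1..m}" "j \<in> {1..m}" "{k, l} \<in> edges G" "i < j" "k < l" for i j k l
        unfolding minor_def using that by (intro ideals.span_base) auto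
      have col: "minor i j k l \<in> ?K"
        if "i \<in> {1..m}" "j \<in> {1..m}" "{k, l} \<in> edges G" "i < j" for i j k l
      proof (cases "k < l")
        case False
        then have "l < k" using edge_in_verts(3)[OF G that(3)] by simp
        then have "- minor i j l k \<in> ?K"
          using that ordered[of i j l k] by (intro ideals.span_neg) (simp add: insert_commute)
        then show ?thesis by (simp add: minor_def)
      qed (use that ordered in blast)
      fix i j k l assume *: "i \<in> {1..m}" "j \<in> {1..m}" "{k, l} \<in> edges G"
      consider "i < j" | "i = j" | "j < i" by linarith
      then show "minor i j k l \<in> ?K"
      proof cases
        case 2
        then show ?thesis using ideals.span_zero by (simp add: minor_def mult.commute)
      next
        case 3
        then have "- minor j i k l \<in> ?K" using * col[of j i k l] by (intro ideals.span_neg) simp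
        then show ?thesis by (simp add: minor_def mult.commute)
      qed (use * col in blast)
    next
      fix i k assume "\<not> (i \<in> {1..m} \<and> k \<in> verts G)"
      then have "var (i, k) \<in> (vars_outside_ideal ?I :: (nat \<times> nat, 'k) mpoly set)"
        unfolding vars_outside_ideal_eq_span by (intro ideals.span_base) auto
      then show "var (i, k) \<in> ?K" by (intro ideals.span_base) blast
    qed simp
  qed
  then show ?thesis
    unfolding gen_binomial_edge_ideal_def edge_poly_ring_def using genideal_mpoly_ring[OF Q] by simp
qed

text \<open>
  The coefficients of a combination of \<open>fs\<close> modulo \<open>K\<close> may involve the variables outside \<open>I\<close>; setting
  these to zero changes the combination only by an element of \<open>K\<close> and leaves \<open>fs\<close> as it is.
\<close>

lemma seq_submodule_quot_module:
  fixes K :: "('i, 'k::comm_ring_1) mpoly set" and I :: "'i set"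
  assumes K: "ideals.subspace K" "vars_outside_ideal I \<subseteq> K" and fs: "set fs \<subseteq> polys_in I"
  defines "R \<equiv> mpoly_ring I" and "J \<equiv> K \<inter> polys_in I"
  shows "seq_submodule (quot_module R J) fs =
           (+>\<^bsub>R\<^esub>) J ` (ideals.span (set fs \<union> K) \<inter> polys_in I)"
  using fs
proof (induction fs)
  case Nil
  have J: "ideal J R" unfolding J_def R_def by (rule ideal_Int_polys_in[OF K(1)])
  interpret J: ideal J R by (rule J)
  have "J +>\<^bsub>R\<^esub> r = J" if "r \<in> J" for r
    using that J.a_rcos_const by simp
  moreover have "0 \<in> J"
    using ideals.subspace_0[OF K(1)] by (simp add: J_def polys_in_def)
  moreover have "ideals.span K \<inter> polys_in I = J"
    unfolding J_def ideals.span_eq_iff[THEN iffD2, OF K(1)] ..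
  ultimately show ?case
    by (auto simp: quot_module_simps FactRing_def R_def)
next
  case (Cons f fs)
  interpret R: cring R unfolding R_def by (rule cring_mpoly_ring)
  have J: "ideal J R" unfolding J_def R_def by (rule ideal_Int_polys_in[OF K(1)])
  interpret J: ideal J R by (rule J)
  interpret h: ring_hom_ring R "R Quot J" "(+>\<^bsub>R\<^esub>) J" by (rule J.rcos_ring_hom_ring)
  let ?M = "quot_module R J" and ?A = "ideals.span (set fs \<union> K)"
  have carrier: "carrier ?M = (+>\<^bsub>R\<^esub>) J ` polys_in I"
    unfolding quot_module_simps FactRing_def A_RCOSETS_def' by (auto simp: R_def)
  have act: "(f \<odot>\<^bsub>?M\<^esub> (J +>\<^bsub>R\<^esub> s)) \<oplus>\<^bsub>?M\<^esub> (J +>\<^bsub>R\<^esub> r) = J +>\<^bsub>R\<^esub> (f * s + r)"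
    if "s \<in> polys_in I" "r \<in> polys_in I" for s r
    using that Cons.prems h.hom_mult[of f s] h.hom_add[of "f * s" r] polys_in_mult[of f I s]
    by (simp add: quot_module_simps R_def)
  have "seq_submodule ?M (f # fs) =
      (+>\<^bsub>R\<^esub>) J ` {f * s + r | s r. s \<in> polys_in I \<and> r \<in> ?A \<inter> polys_in I}" (is "_ = _ ` ?B")
  proof -
    have "seq_submodule ?M (f # fs) =
      {(f \<odot>\<^bsub>?M\<^esub> (J +>\<^bsub>R\<^esub> s)) \<oplus>\<^bsub>?M\<^esub> (J +>\<^bsub>R\<^esub> r) | s r. s \<in> polys_in I \<and> r \<in> ?A \<inter> polys_in I}"
      using Cons.IH Cons.prems by (auto simp: carrier) 
    also have "\<dots> = {J +>\<^bsub>R\<^esub> (f * s + r) | s r. s \<in> polys_in I \<and> r \<in> ?A \<inter> polys_in I}"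
      using act by (intro Collect_cong ex_cong1) auto
    also have "\<dots> = (+>\<^bsub>R\<^esub>) J ` ?B" by blast
    finally show ?thesis .
  qed
  also have "?B = ideals.span (set (f # fs) \<union> K) \<inter> polys_in I"
  proof (intro equalityI subsetI)
    fix x assume "x \<in> ?B"
    then obtain s r where x: "x = f * s + r" "s \<in> polys_in I" "r \<in> ?A" "r \<in> polys_in I" by blast
    have "x - s * f \<in> ?A" using x by (simp add: mult.commute)
    then have "x \<in> ideals.span (insert f (set fs \<union> K))" unfolding ideals.span_insert by blast
    moreover have "x \<in> polys_in I" using x Cons.prems by (simp add: polys_in_add polys_in_mult)
    ultimately show "x \<in> ideals.span (set (f # fs) \<union> K) \<inter> polys_in I" by simp
  next
    fix x assume x: "x \<in> ideals.span (set (f # fs) \<union> K) \<inter> polys_in I"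
    then obtain c where c: "x - c * f \<in> ?A" by (auto simp: ideals.span_insert)
    let ?r = "restrict_vars I"
    have f: "?r f = f" using Cons.prems by (simp add: restrict_vars_id)
    have "(x - c * f) - ?r (x - c * f) \<in> ?A"
      using diff_restrict_vars[of "x - c * f" I] K(2) ideals.span_base by blast
    then have "(x - c * f) - ((x - c * f) - ?r (x - c * f)) \<in> ?A"
      by (rule ideals.span_diff[OF c])
    then have r: "?r (x - c * f) \<in> ?A" by simp
    have "x = ?r x" using x by (simp add: restrict_vars_id)
    also have "\<dots> = f * ?r c + ?r (x - c * f)"
      by (simp add: restrict_vars_diff restrict_vars_mult f mult.commute)
    finally show "x \<in> ?B" using r restrict_vars_in by blast
  qed
  finally show ?case .
qed

lemma regular_sequence_iff:
  fixes K :: "('i, 'k::comm_ring_1) mpoly set" and I :: "'i set"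
  assumes K: "ideals.subspace K" "vars_outside_ideal I \<subseteq> K" and fs: "set fs \<subseteq> polys_in I"
  shows "regular_sequence (mpoly_ring I) (quot_module (mpoly_ring I) (K \<inter> polys_in I)) fs \<longleftrightarrow>
     (\<forall>i<length fs. nonzerodivisor_mod (ideals.span (set (take i fs) \<union> K)) (fs ! i)) \<and>
     1 \<notin> ideals.span (set fs \<union> K)"
proof -
  define R where "R = (mpoly_ring I :: ('i, 'k) mpoly ring)"
  define J where "J = K \<inter> polys_in I"
  let ?M = "quot_module R J"
  let ?A = "\<lambda>fs. ideals.span (set fs \<union> K)"
  interpret R: cring R unfolding R_def by (rule cring_mpoly_ring)
  have J: "ideal J R" unfolding J_def R_def by (rule ideal_Int_polys_in[OF K(1)])
  interpret J: ideal J R by (rule J)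
  interpret h: ring_hom_ring R "R Quot J" "(+>\<^bsub>R\<^esub>) J" by (rule J.rcos_ring_hom_ring)
  have carrier: "carrier ?M = (+>\<^bsub>R\<^esub>) J ` polys_in I"
    unfolding quot_module_simps FactRing_def A_RCOSETS_def' by (auto simp: R_def)
  have mem: "J +>\<^bsub>R\<^esub> r \<in> seq_submodule ?M gs \<longleftrightarrow> r \<in> ?A gs"
    if gs: "set gs \<subseteq> polys_in I" and r: "r \<in> polys_in I" for gs r
  proof
    assume "r \<in> ?A gs"
    then show "J +>\<^bsub>R\<^esub> r \<in> seq_submodule ?M gs"
      unfolding J_def R_def seq_submodule_quot_module[OF K gs] using r by blast
  next
    assume "J +>\<^bsub>R\<^esub> r \<in> seq_submodule ?M gs"
    then obtain s where s: "s \<in> ?A gs" "s \<in> polys_in I" "J +>\<^bsub>R\<^esub> r = J +>\<^bsub>R\<^esub> s"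
      unfolding J_def R_def seq_submodule_quot_module[OF K gs] by blast
    have "r \<in> J +>\<^bsub>R\<^esub> s" using J.a_rcos_self[of r] r s(3) by (simp add: R_def)
    then obtain j where "j \<in> J" "r = j + s" by (auto simp: a_r_coset_def' R_def)
    then show "r \<in> ?A gs" using s(1) ideals.span_base[of j "set gs \<union> K"]
      by (auto simp: J_def intro: ideals.span_add)
  qed
  have nzd: "(\<forall>x\<in>carrier ?M. f \<odot>\<^bsub>?M\<^esub> x \<in> seq_submodule ?M gs \<longrightarrow> x \<in> seq_submodule ?M gs) \<longleftrightarrow>
      nonzerodivisor_mod (?A gs) f"
    if gs: "set gs \<subseteq> polys_in I" and f: "f \<in> polys_in I" for gs f
  proof -
    have "(\<forall>x\<in>carrier ?M. f \<odot>\<^bsub>?M\<^esub> x \<in> seq_submodule ?M gs \<longrightarrow> x \<in> seq_submodule ?M gs) \<longleftrightarrow>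
        (\<forall>s\<in>polys_in I. f * s \<in> ?A gs \<longrightarrow> s \<in> ?A gs)"
    proof -
      have "f \<odot>\<^bsub>?M\<^esub> (J +>\<^bsub>R\<^esub> s) = J +>\<^bsub>R\<^esub> (f * s)" if "s \<in> polys_in I" for s
        using that f h.hom_mult[of f s] by (simp add: quot_module_simps R_def)
      then show ?thesis using mem[OF gs] f polys_in_mult[OF f] by (simp add: carrier)
    qed
    also have "\<dots> \<longleftrightarrow> nonzerodivisor_mod (?A gs) f"
      unfolding nonzerodivisor_mod_def
    proof (intro iffI allI ballI impI)
      fix x assume *: "\<forall>s\<in>polys_in I. f * s \<in> ?A gs \<longrightarrow> s \<in> ?A gs" and x: "f * x \<in> ?A gs"
      let ?r = "restrict_vars I x"
      have d: "x - ?r \<in> ?A gs" using diff_restrict_vars K(2) ideals.span_base by blast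
      have "f * x - f * (x - ?r) \<in> ?A gs" by (intro ideals.span_diff x ideals.span_scale d)
      then have "f * ?r \<in> ?A gs" by (simp add: right_diff_distrib)
      then have "?r \<in> ?A gs" using * restrict_vars_in by blast
      then have "?r + (x - ?r) \<in> ?A gs" using d by (rule ideals.span_add)
      then show "x \<in> ?A gs" by simp
    qed blast
    finally show ?thesis .
  qed
  have "seq_submodule ?M fs \<noteq> carrier ?M \<longleftrightarrow> 1 \<notin> ?A fs"
  proof -
    have one: "1 \<in> polys_in I" by (simp add: polys_in_def monomials_in_def)
    show ?thesis
    proof
      assume "seq_submodule ?M fs \<noteq> carrier ?M"
      show "1 \<notin> ?A fs"
      proof
        assume "1 \<in> ?A fs"
        then have "?A fs = UNIV"
          using ideals.span_scale[of 1 "set fs \<union> K"] by auto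
        then have "seq_submodule ?M fs = carrier ?M"
          unfolding J_def R_def seq_submodule_quot_module[OF K fs] using carrier by (simp add: J_def R_def)
        then show False using \<open>seq_submodule ?M fs \<noteq> carrier ?M\<close> by blast
      qed
    next
      assume "1 \<notin> ?A fs"
      then show "seq_submodule ?M fs \<noteq> carrier ?M" using mem[OF fs one] one by (auto simp: carrier)
    qed
  qed
  moreover have "(\<forall>i<length fs. \<forall>x\<in>carrier ?M. fs ! i \<odot>\<^bsub>?M\<^esub> x \<in> seq_submodule ?M (take i fs) \<longrightarrow>
      x \<in> seq_submodule ?M (take i fs)) \<longleftrightarrow>
      (\<forall>i<length fs. nonzerodivisor_mod (?A (take i fs)) (fs ! i))"
  proof (intro all_cong1 imp_cong refl nzd)
    show "set (take i fs) \<subseteq> polys_in I" for i using fs set_take_subset by fast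
    show "fs ! i \<in> polys_in I" if "i < length fs" for i using that fs by auto
  qed
  ultimately show ?thesis
    using fs unfolding regular_sequence_def R_def[symmetric] J_def[symmetric]
    by (simp add: R_def)
qed

text \<open>
  The elements of a regular sequence may be changed modulo the ideal, hence be taken in the smaller
  polynomial ring.
\<close>

lemma depth_ge_iff_sequence:
  fixes J :: "('i::linorder, 'k::field) mpoly set"
  assumes "ideals.subspace J" "vars_outside_ideal I \<subseteq> J"
  shows "noetherian_over.depth_ge max_ideal k J \<longleftrightarrow>
     (\<exists>fs. length fs = k \<and> set fs \<subseteq> max_ideal \<inter> polys_in I \<and>
        (\<forall>i<k. nonzerodivisor_mod (ideals.span (set (take i fs) \<union> J)) (fs ! i)))"
proof -
  interpret noetherian_over "max_ideal :: ('i, 'k) mpoly set" "vars_outside_ideal {}"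
    by (rule noetherian_over_polys) simp
  show ?thesis
    using assms
  proof (induction k arbitrary: J)
    case (Suc k)
    let ?reg = "\<lambda>fs J. \<forall>i<length fs. nonzerodivisor_mod (ideals.span (set (take i fs) \<union> J)) (fs ! i)"
    have Cons: "?reg (f # fs) J \<longleftrightarrow> nonzerodivisor_mod J f \<and> ?reg fs (adjoin J f)" for f fs
      using Suc.prems(1)
      by (auto simp: less_Suc_eq_0_disj span_Un_adjoin ideals.span_eq_iff[THEN iffD2])
    have adj: "vars_outside_ideal I \<subseteq> adjoin J f" for f using Suc.prems(2) adjoin_superset by blast
    show ?case
    proof
      assume "depth_ge (Suc k) J"
      then obtain f where f: "f \<in> max_ideal" "nonzerodivisor_mod J f" "depth_ge k (adjoin J f)" by auto
      let ?g = "restrict_vars I f"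
      have fg: "f - ?g \<in> J" using Suc.prems(2) diff_restrict_vars by blast
      have "depth_ge k (adjoin J ?g)" using f(3) adjoin_cong[OF Suc.prems(1) fg] by simp
      then obtain fs where fs: "length fs = k" "set fs \<subseteq> max_ideal \<inter> polys_in I" "?reg fs (adjoin J ?g)"
        using Suc.IH[OF ideal_adjoin adj] by blast
      have "?g \<in> max_ideal" using f(1) by (simp add: max_ideal_def lookup_restrict_vars)
      moreover have "?reg (?g # fs) J"
        unfolding Cons using fs(3) nonzerodivisor_mod_cong[OF Suc.prems(1) fg f(2)] by blast
      ultimately show "\<exists>fs. length fs = Suc k \<and> set fs \<subseteq> max_ideal \<inter> polys_in I \<and>
          (\<forall>i<Suc k. nonzerodivisor_mod (ideals.span (set (take i fs) \<union> J)) (fs ! i))"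
        using fs(1,2) restrict_vars_in[of I f] by (intro exI[of _ "?g # fs"]) auto
    next
      assume "\<exists>fs. length fs = Suc k \<and> set fs \<subseteq> max_ideal \<inter> polys_in I \<and>
          (\<forall>i<Suc k. nonzerodivisor_mod (ideals.span (set (take i fs) \<union> J)) (fs ! i))"
      then obtain gs where gs: "length gs = Suc k" "set gs \<subseteq> max_ideal \<inter> polys_in I" "?reg gs J"
        by auto
      then obtain f fs where "gs = f # fs" by (cases gs) auto
      then have fs: "length fs = k" "set (f # fs) \<subseteq> max_ideal \<inter> polys_in I" "?reg (f # fs) J"
        using gs by simp_all
      have "depth_ge k (adjoin J f)"
        using fs Suc.IH[OF ideal_adjoin adj, of f] unfolding Cons by auto
      then show "depth_ge (Suc k) J" using fs(2,3) unfolding Cons by auto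
    qed
  qed simp
qed

theorem depth_edge_quotient_eq:
  fixes G :: "nat sgraph"
  assumes G: "finite_simple_graph G"
    and d: "poly_depth_eq (edge_ideal m G :: (nat \<times> nat, 'k::field) mpoly set) d"
  shows "depth_edge_quotient TYPE('k) m G = enat d"
proof -
  let ?I = "{1..m} \<times> verts G"
  let ?K = "edge_ideal m G :: (nat \<times> nat, 'k) mpoly set"
  let ?M = "quot_module (mpoly_ring ?I) (?K \<inter> polys_in ?I)"
  let ?L = "{enat (length fs) | fs. set fs \<subseteq> max_ideal \<inter> polys_in ?I \<and> regular_sequence (mpoly_ring ?I) ?M fs}"
  interpret noetherian_over "max_ideal :: (nat \<times> nat, 'k) mpoly set" "vars_outside_ideal {}"
    by (rule noetherian_over_polys) simp
  have K: "ideals.subspace ?K" "vars_outside_ideal ?I \<subseteq> ?K"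
    by (simp_all add: ideal_edge_ideal vars_outside_le_edge_ideal)
  have proper: "1 \<notin> ideals.span (set fs \<union> ?K)" if "set fs \<subseteq> max_ideal" for fs
  proof -
    have "ideals.span (set fs \<union> ?K) \<subseteq> max_ideal"
      using that edge_ideal_le_max by (intro ideals.span_minimal ideal_max) auto
    then show ?thesis using one_notin_m by blast
  qed
  have len: "enat k \<in> ?L \<longleftrightarrow> depth_ge k ?K" for k
    unfolding depth_ge_iff_sequence[OF K]
    using regular_sequence_iff[OF K] proper by auto
  have "Sup ?L = enat d"
  proof (rule Sup_eqI)
    fix y assume "y \<in> ?L"
    then obtain k where k: "y = enat k" "depth_ge k ?K" using len by auto
    have "k \<le> d"
    proof (rule ccontr)
      assume "\<not> k \<le> d"
      then have "depth_ge (Suc d) ?K" using k(2) depth_ge_antimono[of k ?K "Suc d"] by simp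
      then show False using d by (simp add: depth_eq_def)
    qed
    then show "y \<le> enat d" by (simp add: k)
  next
    fix y assume "\<And>z. z \<in> ?L \<Longrightarrow> z \<le> y"
    then show "enat d \<le> y" using len[of d] d unfolding depth_eq_def by blast
  qed
  then show ?thesis
    unfolding depth_edge_quotient_def depth_def homogeneous_max_ideal_eq gen_binomial_edge_ideal_eq[OF G]
      edge_poly_ring_def .
qed

theorem theorem5p6:
  fixes m n t :: nat and G :: "nat sgraph"
  assumes "m \<ge> 2" and "n \<ge> 1"
    and "finite_simple_graph G" and "verts G = {1..n}"
    and "strongly_unmixed G"
  shows "(connected_graph G \<longrightarrow>
            depth_edge_quotient TYPE('k::field) m G = enat (m + n - 1)) \<and>
         (num_components G = t \<longrightarrow>
            depth_edge_quotient TYPE('k) m G = enat ((m - 1) * t + n))"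
proof -
  have depth: "depth_edge_quotient TYPE('k) m G = enat ((m - 1) * num_components G + n)"
    using depth_edge_quotient_eq[OF assms(3) depth_strongly_unmixed[OF assms(5,3,1)]] assms(4) by simp
  moreover have "(m - 1) * 1 + n = m + n - 1" using assms(1) by simp
  ultimately show ?thesis using num_components_connected[of G] by auto
qed

end
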